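(* For every integer $m\ge 1$ let $$C(m)=\frac{1}{m!}\int_0^\pi \frac{\theta^{m}}{2}\cot\!\left(\frac{\theta}{2}\right)d\theta .$$ Define the entire series $$K_1(z)=\sum_{j=0}^\infty \binom{2j}{j}\frac{1}{(2j+1)^2}\left(\frac{z}{2}\right)^{2j},\qquad K_0(z)=\frac12\sum_{j=1}^\infty \frac{(4z)^j}{j^3\binom{2j}{j}} .$$ For $l\ge 1$ set $$I_1(l)=\int_{[0,1]^l} K_1(x_1x_2\cdots x_l)\prod_{i=1}^{l}\frac{\log(x_i)}{1-\prod_{m=1}^i x_m^2}\,dx_1\cdots dx_l,$$ $$I_0(l)=\int_{[0,1]^l} K_0(x_1x_2\cdots x_l)\prod_{i=1}^{l}\frac{\log(x_i)}{x_i\left(1-\prod_{m=1}^i x_m\right)}\,dx_1\cdots dx_l,$$ and set $I_1(0)=K_1(1)$, $I_0(0)=K_0(1)$. Then for every integer $k\ge 0$, $$C(2k+1)=\sum_{l=0}^k 2^{2l+1}\frac{\pi^{2k-2l}}{(2k-2l)!}\,I_1(l),\qquad C(2k+2)=\sum_{l=0}^k \frac{\pi^{2k-2l}}{(2k-2l+1)!}\,I_0(l).$$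
   Context: $C(m)$ is the $m$-th (normalized) moment of the cotangent function as defined in the claim; the odd moments are $C(2k+1)$ and the even moments are $C(2k)$. $[0,1]^l$ denotes the unit cube in $\mathbb{R}^l$. *)

theory Defs
  imports "HOL-Analysis.Analysis"
begin

definition C :: "nat \<Rightarrow> real" where
  "C m = 1 / fact m * (LBINT \<theta>:{0..pi}. \<theta> ^ m / 2 * cot (\<theta> / 2))"

(* Both power series converge on [-1, 1], which is where they are used below. *)

definition K1 :: "real \<Rightarrow> real" where
  "K1 z = (\<Sum>j. real ((2 * j) choose j) * (1 / (2 * real j + 1)\<^sup>2) * (z / 2) ^ (2 * j))"

(* The sum over j >= 1 is reindexed with Suc j. *)
definition K0 :: "real \<Rightarrow> real" where
  "K0 z = 1 / 2 * (\<Sum>j. (4 * z) ^ Suc j / (real (Suc j) ^ 3 * real ((2 * Suc j) choose Suc j)))"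

(* R^l is the product of l copies of the real line indexed by {1..l}, with Lebesgue
   measure, so that the dimension l can vary inside one statement. *)

abbreviation unit_cube :: "nat \<Rightarrow> (nat \<Rightarrow> real) set" where
  "unit_cube l \<equiv> Pi\<^sub>E {1..l} (\<lambda>_. {0..1})"

abbreviation lborel_pow :: "nat \<Rightarrow> (nat \<Rightarrow> real) measure" where
  "lborel_pow l \<equiv> Pi\<^sub>M {1..l} (\<lambda>_. lborel)"

definition I1 :: "nat \<Rightarrow> real" where
  "I1 l = (if l = 0 then K1 1
     else LINT x:unit_cube l|lborel_pow l.
       K1 (\<Prod>i=1..l. x i) * (\<Prod>i=1..l. ln (x i) / (1 - (\<Prod>m=1..i. (x m)\<^sup>2))))"

definition I0 :: "nat \<Rightarrow> real" where
  "I0 l = (if l = 0 then K0 1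
     else LINT x:unit_cube l|lborel_pow l.
       K0 (\<Prod>i=1..l. x i) * (\<Prod>i=1..l. ln (x i) / (x i * (1 - (\<Prod>m=1..i. x m)))))"

end

theory Submission
  imports Defs
begin

text \<open>Write \<open>\<theta> = 2 u\<close> and expand \<open>u ^ m / fact m\<close> in powers of \<open>sin u\<close>. For \<open>m = 2 k + p\<close> with
  \<open>p \<in> {1, 2}\<close> the coefficient of \<open>sin u ^ (2 j + p)\<close> is the one for \<open>k = 0\<close> times the elementary
  symmetric polynomial \<open>e\<^sub>k\<close> of the numbers \<open>1 / (2 n + p)\<^sup>2\<close>, \<open>n < j\<close>. Integrating termwise against
  \<open>cot u\<close> makes the moment a weighted sum of these \<open>e\<^sub>k\<close>. An elementary symmetric polynomial
  of an initial segment is an alternating sum of products of \<open>e\<^sub>i\<close> of the whole sequence, which are the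
  powers of \<open>pi\<close> divided by factorials, with complete homogeneous symmetric series \<open>h\<^sub>l\<close> of the tail
  \<open>n \<ge> j\<close>. Expanding all denominators of the cube integrals as geometric series identifies
  them, up to the sign of the \<open>l\<close> logarithms, with the weighted sums of the \<open>h\<^sub>l\<close>.\<close>

section \<open>Power series of powers of the arcsine\<close>

text \<open>The Taylor coefficients of \<open>arcsin x ^ m / fact m\<close>. The recurrence in the second index
  expresses that the second derivative of \<open>u ^ m / fact m\<close> is \<open>u ^ (m - 2) / fact (m - 2)\<close>,
  written in the variable \<open>x = sin u\<close>.\<close>

fun arcsin_coeff :: "nat \<Rightarrow> nat \<Rightarrow> real" where
  "arcsin_coeff m 0 = (if m = 0 then 1 else 0)"
| "arcsin_coeff m (Suc 0) = (if m = 1 then 1 else 0)"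
| "arcsin_coeff m (Suc (Suc n)) =
     ((real n)\<^sup>2 * arcsin_coeff m n + (if m < 2 then 0 else arcsin_coeff (m - 2) n))
       / ((real n + 2) * (real n + 1))"

text \<open>In the recurrence the numerator is at most \<open>n^2 + 1\<close>, which is below the
  denominator. The crude bound 1 already gives convergence for |x| < 1.\<close>

lemma arcsin_coeff_bounds: "0 \<le> arcsin_coeff m n" "arcsin_coeff m n \<le> 1"
proof -
  have "0 \<le> arcsin_coeff m n \<and> arcsin_coeff m n \<le> 1"
  proof (induction m n rule: arcsin_coeff.induct)
    case (3 m n)
    define A where "A = arcsin_coeff m n"
    define B where "B = (if m < 2 then 0 else arcsin_coeff (m - 2) n)"
    have A: "0 \<le> A" "A \<le> 1" using 3 by (auto simp: A_def)
    have B: "0 \<le> B" "B \<le> 1" using 3 by (auto simp: B_def)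
    have "(real n)\<^sup>2 * A \<le> (real n)\<^sup>2"
      using A by (simp add: mult_left_le)
    hence "(real n)\<^sup>2 * A + B \<le> (real n + 2) * (real n + 1)"
      using B by (simp add: algebra_simps power2_eq_square)
    moreover have "0 \<le> (real n)\<^sup>2 * A + B" using A B by simp
    moreover have "arcsin_coeff m (Suc (Suc n)) = ((real n)\<^sup>2 * A + B) / ((real n + 2) * (real n + 1))"
      by (simp add: A_def B_def)
    ultimately show ?case by simp
  qed auto
  thus "0 \<le> arcsin_coeff m n" "arcsin_coeff m n \<le> 1" by auto
qed

lemma summable_arcsin_coeff:
  fixes x :: real
  assumes "\<bar>x\<bar> < 1"
  shows "summable (\<lambda>n. arcsin_coeff m n * x ^ n)"
proof (rule summable_comparison_test)
  show "\<exists>N. \<forall>n\<ge>N. norm (arcsin_coeff m n * x ^ n) \<le> \<bar>x\<bar> ^ n"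
    using arcsin_coeff_bounds[of m] by (auto simp: abs_mult power_abs mult_left_le_one_le)
  show "summable (\<lambda>n. \<bar>x\<bar> ^ n)" using assms by (simp add: summable_geometric)
qed

lemma arcsin_coeff_diffs:
  "diffs (diffs (arcsin_coeff m)) n =
     (real n)\<^sup>2 * arcsin_coeff m n + (if m < 2 then 0 else arcsin_coeff (m - 2) n)"
proof -
  have cancel: "z * y * (w / (y * z)) = w" if "z > 0" "y > 0" for w y z :: real
    using that by simp
  have "diffs (diffs (arcsin_coeff m)) n = (real n + 1) * (real n + 2) * arcsin_coeff m (Suc (Suc n))"
    by (simp add: diffs_def add_ac del: arcsin_coeff.simps)
  also have "\<dots> = (real n)\<^sup>2 * arcsin_coeff m n + (if m < 2 then 0 else arcsin_coeff (m - 2) n)"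
    unfolding arcsin_coeff.simps by (rule cancel) auto
  finally show ?thesis .
qed

text \<open>In the variable \<open>x = sin u\<close> the operator d^2/du^2 becomes (1 - x^2) D^2 - x
  D. Comparing coefficients reduces the equation to \<open>arcsin_coeff_diffs\<close>.\<close>

lemma arcsin_series_ode:
  fixes x :: real
  assumes x: "\<bar>x\<bar> < 1"
  defines "f0 \<equiv> (\<lambda>c. \<Sum>n. (c n :: real) * x ^ n)"
  shows "(1 - x\<^sup>2) * f0 (diffs (diffs (arcsin_coeff m))) - x * f0 (diffs (arcsin_coeff m))
           = (if m < 2 then 0 else f0 (arcsin_coeff (m - 2)))"
proof -
  let ?c = "arcsin_coeff m"
  have s0: "summable (\<lambda>n. ?c n * x ^ n)" if "\<bar>x\<bar> < 1" for x :: real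
    using that by (rule summable_arcsin_coeff)
  have s1: "summable (\<lambda>n. diffs ?c n * x ^ n)" if "\<bar>x\<bar> < 1" for x :: real
    by (rule termdiff_converges[of _ 1]) (use that s0 in auto)
  have s2: "summable (\<lambda>n. diffs (diffs ?c) n * x ^ n)"
    by (rule termdiff_converges[of _ 1]) (use x s1 in auto)
  \<comment> \<open>Multiplying by \<open>x\<close> shifts the index by one, and the term restored
    at index 0 is zero; \<open>b\<close> does the same twice.\<close>
  have a: "(\<lambda>n. real n * ?c n * x ^ n) sums (x * f0 (diffs ?c))"
  proof -
    have "(\<lambda>n. x * (diffs ?c n * x ^ n)) sums (x * f0 (diffs ?c))"
      unfolding f0_def by (intro sums_mult summable_sums s1 x)
    hence "(\<lambda>n. real (Suc n) * ?c (Suc n) * x ^ Suc n) sums (x * f0 (diffs ?c))"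
      by (simp add: diffs_def mult_ac)
    from sums_Suc_imp[OF _ this] show ?thesis by simp
  qed
  have b: "(\<lambda>n. real n * (real n - 1) * ?c n * x ^ n) sums (x\<^sup>2 * f0 (diffs (diffs ?c)))"
  proof -
    have "(\<lambda>n. x\<^sup>2 * (diffs (diffs ?c) n * x ^ n)) sums (x\<^sup>2 * f0 (diffs (diffs ?c)))"
      unfolding f0_def by (intro sums_mult summable_sums s2)
    hence "(\<lambda>n. real (Suc (Suc n)) * (real (Suc (Suc n)) - 1) * ?c (Suc (Suc n)) * x ^ Suc (Suc n))
             sums (x\<^sup>2 * f0 (diffs (diffs ?c)))"
      by (simp add: diffs_def mult_ac power2_eq_square add_ac del: arcsin_coeff.simps)
    hence "(\<lambda>n. real (Suc n) * (real (Suc n) - 1) * ?c (Suc n) * x ^ Suc n)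
             sums (x\<^sup>2 * f0 (diffs (diffs ?c)))"
      by (rule sums_Suc_imp[rotated]) simp
    from sums_Suc_imp[OF _ this] show ?thesis by simp
  qed
  have "(\<lambda>n. diffs (diffs ?c) n * x ^ n - real n * (real n - 1) * ?c n * x ^ n - real n * ?c n * x ^ n)
          sums (f0 (diffs (diffs ?c)) - x\<^sup>2 * f0 (diffs (diffs ?c)) - x * f0 (diffs ?c))"
    by (intro sums_diff a b) (use s2 in \<open>auto simp: f0_def intro: summable_sums\<close>)
  also have "(\<lambda>n. diffs (diffs ?c) n * x ^ n - real n * (real n - 1) * ?c n * x ^ n - real n * ?c n * x ^ n)
          = (\<lambda>n. (if m < 2 then 0 else arcsin_coeff (m - 2) n) * x ^ n)"
    by (auto simp: fun_eq_iff arcsin_coeff_diffs algebra_simps power2_eq_square)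
  finally have "f0 (diffs (diffs ?c)) - x\<^sup>2 * f0 (diffs (diffs ?c)) - x * f0 (diffs ?c) 
      = f0 (\<lambda>n. if m < 2 then 0 else arcsin_coeff (m - 2) n)"
    unfolding f0_def by (simp add: sums_iff)
  thus ?thesis by (auto simp: algebra_simps f0_def)
qed

lemma abs_sin_less_1:
  fixes u :: real
  assumes "\<bar>u\<bar> < pi / 2"
  shows "\<bar>sin u\<bar> < 1"
proof -
  have "cos u > 0" using assms by (intro cos_gt_zero_pi) auto
  hence "(sin u)\<^sup>2 < 1\<^sup>2" by (simp add: sin_squared_eq)
  thus ?thesis by (simp add: abs_square_less_1)
qed

lemma has_derivative_zero_imp_zero:
  fixes d :: "real \<Rightarrow> real"
  assumes "\<And>v. \<bar>v\<bar> < r \<Longrightarrow> (d has_real_derivative 0) (at v)" "d 0 = 0" "\<bar>u\<bar> < r"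
  shows "d u = 0"
proof -
  have "d u = d 0"
    by (rule DERIV_isconst3[of "-r" r]) (use assms in \<open>auto simp: abs_less_iff\<close>)
  thus ?thesis using assms by simp
qed

lemma DERIV_power_div_fact:
  fixes x :: real
  shows "((\<lambda>v. v ^ Suc n / fact (Suc n)) has_real_derivative x ^ n / fact n) (at x)"
proof -
  have "((\<lambda>v. v ^ Suc n / fact (Suc n)) has_real_derivative real (Suc n) * x ^ n / fact (Suc n)) (at x)"
    by (rule DERIV_cdivide) (use DERIV_pow[of "Suc n" x UNIV] in simp)
  thus ?thesis by (simp add: fact_Suc del: of_nat_Suc)
qed

text \<open>As functions of \<open>u\<close>, both sides have the same second derivative, by
  \<open>arcsin_series_ode\<close> and the induction hypothesis at \<open>m - 2\<close>, and the
  same value and slope at 0. The second conjunct, the differentiated series, later yields the limits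
  of \<open>esym\<close>.\<close>

lemma arcsin_power_series:
  fixes u :: real
  assumes "\<bar>u\<bar> < pi / 2"
  shows "(\<Sum>n. arcsin_coeff m n * sin u ^ n) = u ^ m / fact m \<and>
         (m > 0 \<longrightarrow> (\<Sum>n. diffs (arcsin_coeff m) n * sin u ^ n) * cos u = u ^ (m - 1) / fact (m - 1))"
  using assms
proof (induction m arbitrary: u rule: less_induct)
  case (less m)
  let ?c = "arcsin_coeff m"
  define f where "f = (\<lambda>c x. \<Sum>n. (c n :: real) * (x::real) ^ n)"
  have s0: "summable (\<lambda>n. ?c n * x ^ n)" if "\<bar>x\<bar> < 1" for x :: real
    using that by (rule summable_arcsin_coeff)
  have s1: "summable (\<lambda>n. diffs ?c n * x ^ n)" if "\<bar>x\<bar> < 1" for x :: real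
    by (rule termdiff_converges[of _ 1]) (use that s0 in auto)
  have d0: "(f ?c has_real_derivative f (diffs ?c) x) (at x)" if "\<bar>x\<bar> < 1" for x
    unfolding f_def by (rule termdiffs_strong'[of 1]) (use that s0 in auto)
  have d1: "(f (diffs ?c) has_real_derivative f (diffs (diffs ?c)) x) (at x)" if "\<bar>x\<bar> < 1" for x
    unfolding f_def by (rule termdiffs_strong'[of 1]) (use that s1 in auto)
  \<comment> \<open>\<open>h\<close> is the derivative of \<open>v ^ m / fact m\<close>; the case
    \<open>m = 0\<close> is separate because \<open>m - 1\<close> truncates there.\<close>
  define h where "h = (\<lambda>v::real. if m = 0 then 0 else v ^ (m - 1) / fact (m - 1))"
  have hd: "(h has_real_derivative (if m < 2 then 0 else v ^ (m - 2) / fact (m - 2))) (at v)" for v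
  proof (cases "m < 2")
    case True
    hence "h = (\<lambda>_. if m = 0 then 0 else 1)" by (auto simp: h_def fun_eq_iff)
    thus ?thesis using True by simp
  next
    case False
    hence "m = Suc (Suc (m - 2))" by simp
    then obtain m' where m': "m = Suc (Suc m')" by blast
    show ?thesis unfolding h_def m' using DERIV_power_div_fact[of m' v] by simp
  qed
  have ph: "((\<lambda>v. v ^ m / fact m) has_real_derivative h v) (at v)" for v :: real
  proof (cases m)
    case (Suc n)
    thus ?thesis unfolding h_def using DERIV_power_div_fact[of n v] by simp
  qed (simp add: h_def)
  define g where "g = (\<lambda>v. f ?c (sin v))"
  define g1 where "g1 = (\<lambda>v. f (diffs ?c) (sin v) * cos v)"
  have dg: "(g has_real_derivative g1 v) (at v)" if "\<bar>v\<bar> < pi/2" for v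
    unfolding g_def g1_def
    by (rule DERIV_chain2[OF d0 DERIV_sin]) (use that abs_sin_less_1 in auto)
  have dg1: "(g1 has_real_derivative (if m < 2 then 0 else v ^ (m - 2) / fact (m - 2))) (at v)" 
    if v: "\<bar>v\<bar> < pi/2" for v
  proof -
    have sv: "\<bar>sin v\<bar> < 1" using v by (rule abs_sin_less_1)
    have "(g1 has_real_derivative
            ((f (diffs (diffs ?c)) (sin v) * cos v) * cos v + (- sin v) * f (diffs ?c) (sin v))) (at v)"
      unfolding g1_def
      by (rule DERIV_mult[OF DERIV_chain2[OF d1[OF sv] DERIV_sin] DERIV_cos])
    also have "((f (diffs (diffs ?c)) (sin v) * cos v) * cos v + (- sin v) * f (diffs ?c) (sin v))
       = (1 - (sin v)\<^sup>2) * f (diffs (diffs ?c)) (sin v) - sin v * f (diffs ?c) (sin v)"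
      unfolding cos_squared_eq[symmetric] by (simp add: power2_eq_square algebra_simps)
    also have "\<dots> = (if m < 2 then 0 else f (arcsin_coeff (m - 2)) (sin v))"
      unfolding f_def by (rule arcsin_series_ode[OF sv])
    also have "\<dots> = (if m < 2 then 0 else v ^ (m - 2) / fact (m - 2))"
      using less.IH[of "m - 2" v] v by (auto simp: f_def)
    finally show ?thesis .
  qed
  have f0: "f c 0 = c 0" for c unfolding f_def by simp
  \<comment> \<open>The equation is integrated twice: first the derivatives agree, and with that the
    functions themselves.\<close>
  have e1: "g1 v - h v = 0" if "\<bar>v\<bar> < pi/2" for v
  proof (rule has_derivative_zero_imp_zero[of "pi/2" "\<lambda>v. g1 v - h v"])
    fix v :: real assume "\<bar>v\<bar> < pi / 2"
    from DERIV_diff[OF dg1[OF this] hd] show "((\<lambda>v. g1 v - h v) has_real_derivative 0) (at v)" by simp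
  next
    show "g1 0 - h 0 = 0" by (auto simp: g1_def f0 h_def diffs_def)
  qed fact
  have "g u - u ^ m / fact m = 0"
  proof (rule has_derivative_zero_imp_zero[of "pi/2" "\<lambda>v. g v - v ^ m / fact m"])
    fix v :: real assume "\<bar>v\<bar> < pi / 2"
    from DERIV_diff[OF dg[OF this] ph] e1[OF this]
    show "((\<lambda>v. g v - v ^ m / fact m) has_real_derivative 0) (at v)" by simp
  next
    show "g 0 - 0 ^ m / fact m = 0" by (auto simp: g_def f0)
  qed (use less in auto)
  thus ?case using e1[OF less.prems] by (auto simp: g_def g1_def f_def h_def)
qed

section \<open>Symmetric functions of initial segments and tails\<close>

text \<open>\<open>esym a k j\<close> is the elementary symmetric polynomial of degree \<open>k\<close> in \<open>a 0, \<dots>, a (j - 1)\<close>;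
  \<open>hsym a l j\<close> is the complete homogeneous symmetric series of degree \<open>l\<close> in the tail
  \<open>a j, a (j + 1), \<dots>\<close>.\<close>

fun esym :: "(nat \<Rightarrow> real) \<Rightarrow> nat \<Rightarrow> nat \<Rightarrow> real" where
  "esym a 0 j = 1"
| "esym a (Suc k) 0 = 0"
| "esym a (Suc k) (Suc j) = esym a (Suc k) j + a j * esym a k j"

primrec hsym :: "(nat \<Rightarrow> real) \<Rightarrow> nat \<Rightarrow> nat \<Rightarrow> real" where
  "hsym a 0 = (\<lambda>j. 1)"
| "hsym a (Suc l) = (\<lambda>j. \<Sum>n. a (n + j) * hsym a l (n + j))"

lemma esym_0_right: "esym a k 0 = (if k = 0 then 1 else 0)"
  by (cases k) auto

lemma esym_scale: "esym (\<lambda>n. c * a n) k j = c ^ k * esym a k j"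
  by (induction a k j rule: esym.induct) (auto simp: algebra_simps)

lemma esym_nonneg:
  assumes "\<And>n. 0 \<le> a n"
  shows "0 \<le> esym a k j"
  using assms by (induction a k j rule: esym.induct) auto

lemma incseq_esym:
  assumes "\<And>n. 0 \<le> a n"
  shows "incseq (esym a k)"
  by (rule incseq_SucI, cases k) (auto simp: esym_nonneg assms)

text \<open>A tail of a nonnegative series is at most the whole sum. The bound is uniform in
  \<open>j\<close>, so weighting \<open>hsym\<close> by a summable sequence gives a summable
  sequence.\<close>

lemma hsym_bounds:
  assumes "\<And>n. 0 \<le> a n" "summable a"
  shows "0 \<le> hsym a l j \<and> hsym a l j \<le> suminf a ^ l"
proof (induction l arbitrary: j)
  case (Suc l)
  have sa: "summable (\<lambda>n. a (n + j))" using assms by (simp add: summable_iff_shift)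
  have sh: "summable (\<lambda>n. a (n + j) * hsym a l (n + j))"
    by (rule summable_comparison_test[OF _ summable_mult[OF sa, of "suminf a ^ l"]])
       (use Suc assms in \<open>auto simp: mult.commute[of _ "a _"] intro!: mult_left_mono exI[of _ 0]\<close>)
  have "suminf (\<lambda>n. a (n + j)) \<le> suminf a"
    using suminf_minus_initial_segment[OF assms(2), of j] assms(1) by (simp add: sum_nonneg)
  moreover have "(\<Sum>n. a (n + j) * hsym a l (n + j)) \<le> (\<Sum>n. a (n + j) * suminf a ^ l)"
    using Suc assms by (intro suminf_le sh summable_mult2 sa mult_left_mono) auto
  moreover have "\<dots> = (\<Sum>n. a (n + j)) * suminf a ^ l"
    by (rule suminf_mult2[symmetric, OF sa])
  moreover have "\<dots> \<le> suminf a * suminf a ^ l"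
    using assms calculation(1) by (intro mult_right_mono zero_le_power suminf_nonneg)
  ultimately have "(\<Sum>n. a (n + j) * hsym a l (n + j)) \<le> suminf a * suminf a ^ l"
    by linarith
  thus ?case using Suc assms by (auto intro!: suminf_nonneg sh)
qed simp

lemma summable_hsym:
  assumes "\<And>n. 0 \<le> a n" "summable a"
  shows "summable (\<lambda>n. a n * hsym a l n)"
  by (rule summable_comparison_test[OF _ summable_mult[OF assms(2), of "suminf a ^ l"]])
     (use assms hsym_bounds[OF assms] in \<open>auto simp: mult.commute abs_mult intro!: mult_left_mono exI[of _ 0]\<close>)

text \<open>A monomial in the tail either contains \<open>a j\<close> or lives on the shorter tail.
  This is the counterpart of the recursion of \<open>esym\<close>.\<close>

lemma hsym_Suc_step:
  assumes "\<And>n. 0 \<le> a n" "summable a"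
  shows "hsym a (Suc l) j = a j * hsym a l j + hsym a (Suc l) (Suc j)"
proof -
  have "summable (\<lambda>n. a (n + j) * hsym a l (n + j))"
    using summable_hsym[OF assms] by (rule summable_ignore_initial_segment)
  from suminf_split_head[OF this] show ?thesis by simp
qed

lemma hsym_Suc_tendsto_0:
  assumes "\<And>n. 0 \<le> a n" "summable a"
  shows "hsym a (Suc l) \<longlonglongrightarrow> 0"
  using suminf_exist_split2[OF summable_hsym[OF assms]] by simp

text \<open>This is the coefficientwise form of
  \<open>\<Prod>\<^bsub>n<j\<^esub> (1 + a\<^sub>n z) = \<Prod>\<^bsub>n\<ge>0\<^esub> (1 + a\<^sub>n z) / \<Prod>\<^bsub>n\<ge>j\<^esub> (1 + a\<^sub>n z)\<close>.\<close>

lemma esym_eq_sum_hsym: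
  assumes "\<And>n. 0 \<le> a n" "summable a" and lim: "\<And>k. esym a k \<longlonglongrightarrow> e k"
  shows "esym a k j = (\<Sum>l\<le>k. (-1) ^ l * hsym a l j * e (k - l))"
proof (induction k arbitrary: j)
  case 0
  have "e 0 = 1" by (rule LIMSEQ_unique[OF lim]) (simp add: LIMSEQ_def)
  thus ?case by simp
next
  case (Suc k)
  \<comment> \<open>\<open>F\<close> is the claimed right-hand side in degree \<open>Suc k\<close>.
    By the induction hypothesis its increments in \<open>j\<close> are those of \<open>esym\<close>,
    so the difference is constant in \<open>j\<close>; its limit 0 determines the constant.\<close>
  define F where "F = (\<lambda>j. \<Sum>l\<le>Suc k. (-1) ^ l * hsym a l j * e (Suc k - l))"
  have F: "F j = e (Suc k) + (\<Sum>l\<le>k. (-1) ^ Suc l * hsym a (Suc l) j * e (k - l))" for j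
    unfolding F_def by (subst sum.atMost_Suc_shift) (simp del: hsym.simps(2))
  have step: "F (Suc j) - F j = esym a (Suc k) (Suc j) - esym a (Suc k) j" for j
  proof -
    have "F (Suc j) - F j = (\<Sum>l\<le>k. (-1) ^ Suc l * (hsym a (Suc l) (Suc j) - hsym a (Suc l) j) * e (k - l))"
      unfolding F by (simp add: sum_subtractf[symmetric] ring_distribs del: hsym.simps(2))
    also have "\<dots> = (\<Sum>l\<le>k. a j * ((-1) ^ l * hsym a l j * e (k - l)))"
      by (rule sum.cong) (simp_all add: hsym_Suc_step[OF assms(1,2), of _ j] del: hsym.simps(2))
    also have "\<dots> = a j * esym a k j"
      by (simp add: Suc.IH sum_distrib_left)
    finally show ?thesis by simp
  qed
  have const: "F j - esym a (Suc k) j = F 0 - esym a (Suc k) 0" for j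
  proof (induction j)
    case (Suc j)
    thus ?case using step[of j] by linarith
  qed simp
  \<comment> \<open>Only the summand with \<open>hsym a 0\<close> survives in the limit.\<close>
  have "F \<longlonglongrightarrow> e (Suc k) + (\<Sum>l\<le>k. (-1) ^ Suc l * 0 * e (k - l))"
    unfolding F by (intro tendsto_intros hsym_Suc_tendsto_0 assms)
  hence "(\<lambda>j. F j - esym a (Suc k) j) \<longlonglongrightarrow> 0"
    using tendsto_diff[OF _ lim[of "Suc k"], of F "e (Suc k)"] by simp
  hence "F 0 - esym a (Suc k) 0 = 0"
    by (subst (asm) const) (simp add: LIMSEQ_const_iff)
  with const[of j] show ?case by (simp add: F_def)
qed

section \<open>The arcsine coefficients as symmetric functions\<close>

text \<open>The recurrence lowers the second index by 2 and the first by 0 or 2, so the parity of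
  the sum is preserved.\<close>

lemma arcsin_coeff_parity: "odd (m + n) \<Longrightarrow> arcsin_coeff m n = 0"
  by (induction m n rule: arcsin_coeff.induct) (auto simp: odd_pos)

lemma arcsin_coeff_0_left: "arcsin_coeff 0 n = (if n = 0 then 1 else 0)"
proof -
  have "arcsin_coeff m n = (if n = 0 then 1 else 0)" if "m = 0" for m
    using that by (induction m n rule: arcsin_coeff.induct) auto
  thus ?thesis by simp
qed

text \<open>After division by the coefficient for \<open>k = 0\<close>, which absorbs the factor
  \<open>n^2\<close>, the recurrence at \<open>n = 2 * j + p\<close> becomes the recursion of
  \<open>esym\<close> with new entry \<open>1 / n^2\<close>.\<close>

lemma arcsin_coeff_eq_esym:
  assumes p: "p \<in> {1, 2}"
  shows "arcsin_coeff (2 * k + p) (2 * j + p)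
           = arcsin_coeff p (2 * j + p) * esym (\<lambda>n. 1 / (2 * real n + real p)\<^sup>2) k j"
proof (induction j arbitrary: k)
  case 0
  have "arcsin_coeff (2 * k + p) p = (if k = 0 then arcsin_coeff p p else 0)"
    using p by (auto simp: numeral_2_eq_2)
  thus ?case by (simp add: esym_0_right)
next
  case (Suc j)
  define n where "n = 2 * j + p"
  have n: "2 * Suc j + p = Suc (Suc n)" by (simp add: n_def)
  have n0: "n > 0" using p by (auto simp: n_def)
  have n': "2 * real j + real p = real n" by (simp add: n_def)
  define A where "A = (\<lambda>k. arcsin_coeff (2 * k + p) n)"
  define E where "E = esym (\<lambda>n. 1 / (2 * real n + real p)\<^sup>2)"
  \<comment> \<open>For \<open>p = 2\<close> the inhomogeneous term is
    \<open>arcsin_coeff 0 n\<close>, which vanishes since \<open>n > 0\<close>.\<close>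
  have p0: "arcsin_coeff p (Suc (Suc n)) = (real n)\<^sup>2 * A 0 / ((real n + 2) * (real n + 1))"
    using p n0 by (auto simp: A_def arcsin_coeff_0_left)
  have IH: "A k = A 0 * E k j" for k
    using Suc.IH[of k] by (simp add: A_def E_def n_def)
  show ?case
  proof (cases k)
    case (Suc k')
    have "arcsin_coeff (2 * k + p) (Suc (Suc n)) = ((real n)\<^sup>2 * A k + A k') / ((real n + 2) * (real n + 1))"
      using p by (auto simp: A_def Suc)
    also have "(real n)\<^sup>2 * A k + A k' = (real n)\<^sup>2 * A 0 * (E k j + 1 / (real n)\<^sup>2 * E k' j)"
      using n0 by (simp add: IH[of k] IH[of k'] field_simps)
    also have "E k j + 1 / (real n)\<^sup>2 * E k' j = E k (Suc j)"
      by (simp add: E_def Suc n')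
    finally show ?thesis unfolding n p0 by (simp add: E_def)
  qed (simp add: E_def)
qed

text \<open>Parity removes all other indices except 0 in the case \<open>p = 2\<close>, where the
  coefficient vanishes because the first index is positive.\<close>

lemma arcsin_coeff_sums:
  assumes p: "p \<in> {1, 2}" and u: "\<bar>u\<bar> < pi / 2"
  shows "(\<lambda>j. arcsin_coeff (2 * k + p) (2 * j + p) * sin u ^ (2 * j + p)) sums
           (u ^ (2 * k + p) / fact (2 * k + p))"
proof -
  have "(\<lambda>n. arcsin_coeff (2 * k + p) n * sin u ^ n) sums (u ^ (2 * k + p) / fact (2 * k + p))"
    using arcsin_power_series[OF u] summable_arcsin_coeff[OF abs_sin_less_1[OF u]]
    by (metis summable_sums)
  moreover have "strict_mono (\<lambda>j. 2 * j + p)" by (auto simp: strict_mono_def)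
  moreover have "arcsin_coeff (2 * k + p) n * sin u ^ n = 0" if n: "n \<notin> range (\<lambda>j. 2 * j + p)" for n
  proof (cases "n < p")
    case True
    hence "n = 0 \<or> (p = 2 \<and> n = 1)" using p by auto
    thus ?thesis using p by (auto simp: arcsin_coeff_parity)
  next
    case False
    have "odd (2 * k + p + n)"
    proof
      assume "even (2 * k + p + n)"
      hence "even (n - p)" using False by (metis dvd_add_right_iff dvd_triv_left even_diff_nat even_add)
      then obtain j where "n - p = 2 * j" by (elim evenE)
      hence "n = 2 * j + p" using False by simp
      thus False using n by blast
    qed
    thus ?thesis by (simp add: arcsin_coeff_parity)
  qed
  ultimately show ?thesis
    using sums_mono_reindex[of "\<lambda>j. 2 * j + p" "\<lambda>n. arcsin_coeff (2 * k + p) n * sin u ^ n"] by simp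
qed

text \<open>The same reindexing for the derivative. The factor \<open>1 / cos u\<close> comes from
  the chain rule, and \<open>p\<close> being positive keeps \<open>2 * j + p - 1\<close> free of
  truncation.\<close>

lemma arcsin_coeff_diffs_sums:
  assumes p: "p \<in> {1, 2}" and u: "\<bar>u\<bar> < pi / 2"
  shows "(\<lambda>j. (2 * real j + p) * arcsin_coeff (2 * k + p) (2 * j + p) * sin u ^ (2 * j + p - 1)) sums
           (u ^ (2 * k + p - 1) / fact (2 * k + p - 1) / cos u)"
proof -
  have s1: "summable (\<lambda>n. diffs (arcsin_coeff (2 * k + p)) n * sin u ^ n)"
    by (rule termdiff_converges[of _ 1]) (use abs_sin_less_1[OF u] summable_arcsin_coeff in auto)
  have "cos u > 0" using u by (intro cos_gt_zero_pi) auto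
  hence "(\<Sum>n. diffs (arcsin_coeff (2 * k + p)) n * sin u ^ n) = u ^ (2 * k + p - 1) / fact (2 * k + p - 1) / cos u"
    using arcsin_power_series[OF u, of "2 * k + p"] p by (auto simp: field_simps)
  hence "(\<lambda>n. diffs (arcsin_coeff (2 * k + p)) n * sin u ^ n) sums
           (u ^ (2 * k + p - 1) / fact (2 * k + p - 1) / cos u)"
    using s1 by (metis summable_sums)
  moreover have "strict_mono (\<lambda>j. 2 * j + p - 1)" using p by (auto simp: strict_mono_def)
  moreover have "diffs (arcsin_coeff (2 * k + p)) n * sin u ^ n = 0" if n: "n \<notin> range (\<lambda>j. 2 * j + p - 1)" for n
  proof -
    have "odd (2 * k + p + Suc n)"
    proof
      assume ev: "even (2 * k + p + Suc n)"
      have "\<exists>j. n = 2 * j + p - 1"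
      proof (cases "p = 1")
        case True
        thus ?thesis using ev by (auto elim!: evenE)
      next
        case False
        hence "p = 2" "odd n" using p ev by auto
        thus ?thesis by (auto elim!: oddE)
      qed
      thus False using n by blast
    qed
    thus ?thesis by (simp add: diffs_def arcsin_coeff_parity)
  qed
  ultimately have "(\<lambda>j. diffs (arcsin_coeff (2 * k + p)) (2 * j + p - 1) * sin u ^ (2 * j + p - 1)) sums
           (u ^ (2 * k + p - 1) / fact (2 * k + p - 1) / cos u)"
    using sums_mono_reindex[of "\<lambda>j. 2 * j + p - 1" "\<lambda>n. diffs (arcsin_coeff (2 * k + p)) n * sin u ^ n"] by simp
  moreover have "Suc (2 * j + p - 1) = 2 * j + p" "real (Suc (2 * j + p - 1)) = 2 * real j + p" for j using p by auto
  ultimately show ?thesis by (simp only: diffs_def)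
qed

text \<open>The limit is read off the differentiated arcsine series: as \<open>u\<close> tends to \<open>pi / 2\<close>, its terms of
  small index are killed by the factor \<open>cos u\<close>, and \<open>esym a k\<close> is monotone.\<close>

lemma esym_tendsto:
  assumes p: "p \<in> {1, 2}"
  defines "a \<equiv> (\<lambda>n. 1 / (2 * real n + real p)\<^sup>2)"
  shows "esym a k \<longlonglongrightarrow> (pi / 2) ^ (2 * k) / fact (2 * k + p - 1)"
proof -
  \<comment> \<open>\<open>W j\<close> is the coefficient for \<open>k = 0\<close>. By
    \<open>sm\<close> the series with coefficients \<open>W j * esym a k j\<close> sums to
    \<open>\<psi> k u / cos u\<close>, and both estimates of the limit compare this series with the
    one for \<open>k = 0\<close>.\<close>
  define W where "W = (\<lambda>j. (2 * real j + p) * arcsin_coeff p (2 * j + p))"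
  define \<psi> where "\<psi> = (\<lambda>k (u::real). u ^ (2 * k + p - 1) / fact (2 * k + p - 1))"
  have W: "W j \<ge> 0" for j using arcsin_coeff_bounds by (auto simp: W_def)
  have a: "a n \<ge> 0" for n by (simp add: a_def)
  have sm: "(\<lambda>j. W j * esym a k j * sin u ^ (2 * j + p - 1)) sums (\<psi> k u / cos u)" if "\<bar>u\<bar> < pi / 2" for u k
    using arcsin_coeff_diffs_sums[OF p that, of k]
    unfolding arcsin_coeff_eq_esym[OF p, folded a_def] \<psi>_def W_def by (simp add: mult.assoc)
  have ev: "\<forall>\<^sub>F u in at_left (pi/2). 0 < u \<and> u < pi / 2"
    using eventually_at_left_real[of 0 "pi/2"] by simp
  have \<psi>: "((\<lambda>u. \<psi> k u) \<longlongrightarrow> \<psi> k (pi/2)) (at_left (pi/2))" for k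
    unfolding \<psi>_def by (intro tendsto_intros) auto
  \<comment> \<open>By monotonicity \<open>esym a k J\<close> bounds all later values from below.
    The finitely many terms with \<open>j < J\<close> cost a constant multiple of
    \<open>cos u\<close>, which tends to 0.\<close>
  have lower: "esym a k J * \<psi> 0 (pi/2) \<le> \<psi> k (pi/2)" for J
  proof -
    define E where "E = esym a k J"
    have E0: "E \<ge> 0" using esym_nonneg[of a] a by (simp add: E_def)
    have "E * \<psi> 0 u - cos u * (E * (\<Sum>j<J. W j)) \<le> \<psi> k u" if u: "0 < u \<and> u < pi / 2" for u
    proof -
      have u': "\<bar>u\<bar> < pi/2" using u by auto
      have c: "cos u > 0" using u' by (intro cos_gt_zero_pi) auto
      have s: "0 \<le> sin u" "sin u \<le> 1" using u by (auto intro: sin_ge_zero)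
      have "(\<lambda>j. E * (W j * esym a 0 j * sin u ^ (2 * j + p - 1)) - (if j < J then E * W j else 0)) sums
              (E * (\<psi> 0 u / cos u) - (\<Sum>j<J. E * W j))"
        using sums_If_finite_set[of "{..<J}" "\<lambda>j. E * W j"] by (intro sums_diff sums_mult sm u') simp
      hence "E * (\<psi> 0 u / cos u) - (\<Sum>j<J. E * W j) \<le> \<psi> k u / cos u"
      proof (rule sums_le[rotated])
        show "(\<lambda>j. W j * esym a k j * sin u ^ (2 * j + p - 1)) sums (\<psi> k u / cos u)" using sm[OF u'] .
        fix j
        have pw: "0 \<le> sin u ^ (2 * j + p - 1)" "sin u ^ (2 * j + p - 1) \<le> 1" using s by (auto intro: power_le_one)
        show "E * (W j * esym a 0 j * sin u ^ (2 * j + p - 1)) - (if j < J then E * W j else 0)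
                \<le> W j * esym a k j * sin u ^ (2 * j + p - 1)"
        proof (cases "j < J")
          case True
          have "E * W j * sin u ^ (2 * j + p - 1) \<le> E * W j"
            using pw W[of j] E0 by (intro mult_left_le) auto
          moreover have "0 \<le> W j * esym a k j * sin u ^ (2 * j + p - 1)"
            using pw W[of j] esym_nonneg[of a] a by auto
          ultimately show ?thesis using True by (simp add: mult.assoc)
        next
          case False
          hence "E \<le> esym a k j" using incseqD[OF incseq_esym[OF a]] by (simp add: E_def)
          hence "E * (W j * sin u ^ (2 * j + p - 1)) \<le> esym a k j * (W j * sin u ^ (2 * j + p - 1))"
            using pw W[of j] by (intro mult_right_mono) auto
          thus ?thesis using False by (simp add: mult_ac)
        qed
      qed
      hence "cos u * (E * (\<psi> 0 u / cos u) - (\<Sum>j<J. E * W j)) \<le> cos u * (\<psi> k u / cos u)"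
        using c by (intro mult_left_mono) auto
      thus ?thesis using c by (simp add: right_diff_distrib sum_distrib_left)
    qed
    hence "\<forall>\<^sub>F u in at_left (pi/2). E * \<psi> 0 u - cos u * (E * (\<Sum>j<J. W j)) \<le> \<psi> k u"
      using ev by (auto elim: eventually_mono)
    moreover have "((\<lambda>u. E * \<psi> 0 u - cos u * (E * (\<Sum>j<J. W j))) \<longlongrightarrow>
        E * \<psi> 0 (pi/2) - cos (pi/2) * (E * (\<Sum>j<J. W j))) (at_left (pi/2))"
      by (intro tendsto_intros \<psi>)
    ultimately have "E * \<psi> 0 (pi/2) - cos (pi/2) * (E * (\<Sum>j<J. W j)) \<le> \<psi> k (pi/2)"
      by (intro tendsto_le[OF trivial_limit_at_left_real \<psi>[of k]])
    thus ?thesis by (simp add: E_def)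
  qed
  have \<psi>0: "\<psi> 0 (pi/2) > 0" by (simp add: \<psi>_def)
  have bd: "esym a k J \<le> \<psi> k (pi/2) / \<psi> 0 (pi/2)" for J
    using lower[of J] \<psi>0 by (simp add: field_simps)
  obtain L where L: "esym a k \<longlonglongrightarrow> L" "\<And>j. esym a k j \<le> L"
    using incseq_convergent[OF incseq_esym[of a k, OF a]] bd by blast
  \<comment> \<open>Conversely, every \<open>esym a k j\<close> is at most the limit
    \<open>L\<close>, so the two series compare termwise.\<close>
  have "\<psi> k u \<le> L * \<psi> 0 u" if u: "0 < u \<and> u < pi / 2" for u
  proof -
    have u': "\<bar>u\<bar> < pi/2" using u by auto
    have c: "cos u > 0" using u' by (intro cos_gt_zero_pi) auto
    have s: "0 \<le> sin u" using u by (auto intro: sin_ge_zero)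
    have "\<psi> k u / cos u \<le> L * (\<psi> 0 u / cos u)"
    proof (rule sums_le[OF _ sm[OF u'] sums_mult[OF sm[OF u']]])
      fix j
      have "esym a k j * (W j * sin u ^ (2 * j + p - 1)) \<le> L * (W j * sin u ^ (2 * j + p - 1))"
        using L(2) W s by (intro mult_right_mono) auto
      thus "W j * esym a k j * sin u ^ (2 * j + p - 1) \<le> L * (W j * esym a 0 j * sin u ^ (2 * j + p - 1))"
        by (simp add: mult_ac)
    qed
    thus ?thesis using c by (simp add: field_simps)
  qed
  hence "\<forall>\<^sub>F u in at_left (pi/2). \<psi> k u \<le> L * \<psi> 0 u"
    using ev by (auto elim: eventually_mono)
  hence "\<psi> k (pi/2) \<le> L * \<psi> 0 (pi/2)"
    by (rule tendsto_le[OF trivial_limit_at_left_real tendsto_mult_left[OF \<psi>[of 0]] \<psi>[of k]])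
  hence "\<psi> k (pi/2) / \<psi> 0 (pi/2) \<le> L" using \<psi>0 by (simp add: field_simps)
  moreover have "L \<le> \<psi> k (pi/2) / \<psi> 0 (pi/2)"
    by (rule LIMSEQ_le_const2[OF L(1)]) (use bd in auto)
  ultimately have "L = \<psi> k (pi/2) / \<psi> 0 (pi/2)" by simp
  also have "\<dots> = (pi / 2) ^ (2 * k) / fact (2 * k + p - 1)"
    using p by (auto simp: \<psi>_def)
  finally show ?thesis using L(1) by simp
qed

section \<open>Integrals over the cube\<close>

text \<open>The minus signs make the kernel nonnegative on the cube. The exponent \<open>q\<close>
  is 2 for \<open>I1\<close> and 1 for \<open>I0\<close>.\<close>

definition cube_kernel :: "nat \<Rightarrow> nat \<Rightarrow> (nat \<Rightarrow> real) \<Rightarrow> real" where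
  "cube_kernel q l x = (\<Prod>i=1..l. - ln (x i) / (1 - (\<Prod>m=1..i. x m ^ q)))"

lemma nn_integral_power_ln:
  "(\<integral>\<^sup>+x. ennreal (x ^ n * - ln x) * indicator {0..1} x \<partial>lborel) = ennreal (1 / (real n + 1)\<^sup>2)"
proof -
  \<comment> \<open>The antiderivative from integration by parts, grouped around
    \<open>x * ln x\<close> to show its continuity at 0.\<close>
  define F where "F = (\<lambda>x::real. x ^ Suc n / (real n + 1)\<^sup>2 - x ^ n * (x * ln x) / (real n + 1))"
  have "continuous_on {0..1} (\<lambda>x::real. x * ln x)"
  proof (rule continuous_on_IccI)
    fix x :: real assume "0 < x" "x < 1"
    thus "(\<lambda>x. x * ln x) \<midarrow>x\<rightarrow> x * ln x" by (auto intro!: tendsto_intros)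
  next
    show "((\<lambda>x::real. x * ln x) \<longlongrightarrow> 0 * ln 0) (at_right 0)"
      by real_asymp
    show "((\<lambda>x::real. x * ln x) \<longlongrightarrow> 1 * ln 1) (at_left 1)"
      by (auto intro!: tendsto_eq_intros)
  qed simp
  hence "continuous_on {0..1} (\<lambda>x::real. x ^ n * (x * ln x))"
    by (rule continuous_on_mult[rotated]) (intro continuous_intros)
  hence cont: "continuous_on {0..1} F"
    unfolding F_def by (intro continuous_on_diff continuous_on_divide) (auto intro!: continuous_on_power simp del: power_Suc)
  have "((\<lambda>x. x ^ n * - ln x) has_integral (F 1 - F 0)) {0..1}"
  proof (rule fundamental_theorem_of_calculus_interior[OF _ cont])
    fix x :: real assume x: "x \<in> {0<..<1}"
    have "((\<lambda>x. x ^ Suc n / (real n + 1)\<^sup>2 - x ^ Suc n * ln x / (real n + 1)) has_real_derivative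
            (real n + 1) * x ^ n / (real n + 1)\<^sup>2
              - ((real n + 1) * x ^ n * ln x + (1 / x) * x ^ Suc n) / (real n + 1)) (at x)"
      using x DERIV_pow[of "Suc n" x UNIV]
      by (intro DERIV_diff DERIV_cdivide DERIV_mult DERIV_ln_divide) (auto simp: add_ac)
    also have "(real n + 1) * x ^ n / (real n + 1)\<^sup>2
              - ((real n + 1) * x ^ n * ln x + (1 / x) * x ^ Suc n) / (real n + 1) = x ^ n * - ln x"
      using x by (simp add: add_divide_distrib power2_eq_square) 
    also have "(\<lambda>x. x ^ Suc n / (real n + 1)\<^sup>2 - x ^ Suc n * ln x / (real n + 1)) = F"
      by (simp add: F_def fun_eq_iff mult_ac)
    finally show "(F has_vector_derivative x ^ n * - ln x) (at x)"
      by (simp add: has_real_derivative_iff_has_vector_derivative)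
  qed auto
  also have "F 1 - F 0 = 1 / (real n + 1)\<^sup>2" by (simp add: F_def)
  finally show ?thesis
  proof (rule nn_integral_has_integral_lebesgue'[rotated])
    fix x :: real assume "x \<in> {0..1}"
    hence "ln x \<le> 0" "0 \<le> x ^ n" by (cases "x = 0"; simp)+
    thus "0 \<le> x ^ n * - ln x" by (simp add: mult_nonneg_nonpos)
  qed
qed

text \<open>The denominator is expanded as a geometric series and integrated termwise. In the
  application \<open>P\<close> is a power of the product of the earlier coordinates, so
  \<open>P = 1\<close> has to be allowed.\<close>

lemma nn_integral_power_ln_geometric:
  assumes P: "0 \<le> P" "P \<le> 1" and q: "q > 0"
  shows "(\<integral>\<^sup>+x. ennreal (x ^ (q * j) * (- ln x / (1 - P * x ^ q))) * indicator {0..1} x \<partial>lborel)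
          = (\<Sum>n. ennreal (P ^ n * (1 / (real (q * (n + j)) + 1)\<^sup>2)))"
proof -
  have "(\<integral>\<^sup>+x. ennreal (x ^ (q * j) * (- ln x / (1 - P * x ^ q))) * indicator {0..1} x \<partial>lborel)
      = (\<integral>\<^sup>+x. (\<Sum>n. ennreal (P ^ n) * (ennreal (x ^ (q * (n + j)) * - ln x) * indicator {0..1} x)) \<partial>lborel)"
  \<comment> \<open>The endpoints are null sets; inside the interval \<open>P * x ^ q < 1\<close>
    holds even for \<open>P = 1\<close>.\<close>
  proof (rule nn_integral_cong_AE, use AE_lborel_singleton[of 0] AE_lborel_singleton[of 1] in eventually_elim)
    fix x :: real assume x: "x \<noteq> 0" "x \<noteq> 1"
    show "ennreal (x ^ (q * j) * (- ln x / (1 - P * x ^ q))) * indicator {0..1} x =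
           (\<Sum>n. ennreal (P ^ n) * (ennreal (x ^ (q * (n + j)) * - ln x) * indicator {0..1} x))"
    proof (cases "x \<in> {0<..<1}")
      case False
      thus ?thesis using x by (auto simp: indicator_def)
    next
      case True
      hence x01: "0 < x" "x < 1" by auto
      have xq: "0 \<le> x ^ q" "x ^ q < 1" using x01 q by (auto simp: power_less_one_iff)
      have "P * x ^ q \<le> x ^ q" using P xq by (simp add: mult_left_le_one_le)
      hence Pxq: "P * x ^ q < 1" "0 \<le> P * x ^ q" using xq P by auto
      have summand: "(x ^ (q * j) * - ln x) * (P * x ^ q) ^ n = P ^ n * (x ^ (q * (n + j)) * - ln x)" for n
        by (simp add: power_mult_distrib power_mult[symmetric] power_add distrib_left)
      have "(\<lambda>n. (x ^ (q * j) * - ln x) * (P * x ^ q) ^ n) sums ((x ^ (q * j) * - ln x) * (1 / (1 - P * x ^ q)))"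
        using Pxq by (intro sums_mult geometric_sums) auto
      hence "(\<lambda>n. P ^ n * (x ^ (q * (n + j)) * - ln x)) sums (x ^ (q * j) * (- ln x / (1 - P * x ^ q)))"
        by (simp only: summand)
           (simp add: mult.assoc)
      hence "(\<Sum>n. ennreal (P ^ n * (x ^ (q * (n + j)) * - ln x))) = ennreal (x ^ (q * j) * (- ln x / (1 - P * x ^ q)))"
        by (intro suminf_ennreal_eq) (use P x01 in \<open>auto simp: mult_nonneg_nonpos\<close>)
      hence "(\<Sum>n. ennreal (P ^ n) * ennreal (x ^ (q * (n + j)) * - ln x)) = ennreal (x ^ (q * j) * (- ln x / (1 - P * x ^ q)))"
        by (simp only: ennreal_mult' zero_le_power P)
      thus ?thesis using x01 by (simp add: indicator_def)
    qed
  qed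
  also have "\<dots> = (\<Sum>n. ennreal (P ^ n) * ennreal (1 / (real (q * (n + j)) + 1)\<^sup>2))"
    by (subst nn_integral_suminf, measurable)
       (intro suminf_cong, subst nn_integral_cmult, measurable, simp only: nn_integral_power_ln)
  also have "\<dots> = (\<Sum>n. ennreal (P ^ n * (1 / (real (q * (n + j)) + 1)\<^sup>2)))"
    by (simp only: ennreal_mult' zero_le_power P)
  finally show ?thesis .
qed

lemma summable_inverse_square_linear:
  assumes "q > 0"
  shows "summable (\<lambda>n. 1 / (real (q * n) + 1)\<^sup>2)"
proof (rule summable_comparison_test)
  show "summable (\<lambda>n. 1 / real (Suc n) ^ 2)"
    using inverse_power_summable[of 2, where 'a = real] by (subst summable_Suc_iff) (simp add: inverse_eq_divide)
  have "1 / (real (q * n) + 1)\<^sup>2 \<le> 1 / real (Suc n) ^ 2" for n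
  proof -
    have "real n \<le> real (q * n)" using assms by (simp only: of_nat_le_iff) simp
    thus ?thesis by (intro divide_left_mono power_mono) (auto intro!: mult_pos_pos)
  qed
  thus "\<exists>N. \<forall>n\<ge>N. norm (1 / (real (q * n) + 1)\<^sup>2) \<le> 1 / real (Suc n) ^ 2" by auto
qed

lemma unit_cube_prod:
  assumes "x \<in> unit_cube l" "i \<le> l"
  shows "0 \<le> (\<Prod>m=1..i. x m)" "(\<Prod>m=1..i. x m) \<le> 1"
  using assms by (auto intro!: prod_nonneg prod_le_1 simp: PiE_iff)

lemma cube_kernel_nonneg:
  assumes "x \<in> unit_cube l"
  shows "0 \<le> cube_kernel q l x"
  unfolding cube_kernel_def
proof (rule prod_nonneg)
  fix i assume i: "i \<in> {1..l}"
  have "(\<Prod>m=1..i. x m) ^ q \<le> 1"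
    using unit_cube_prod[OF assms, of i] i by (intro power_le_one) auto
  moreover have "ln (x i) \<le> 0" using assms i by (cases "x i = 0") (auto simp: PiE_iff less_le)
  ultimately show "0 \<le> - ln (x i) / (1 - (\<Prod>m=1..i. x m ^ q))"
    by (simp add: prod_power_distrib[symmetric] divide_nonpos_nonneg)
qed

lemma measurable_cube_kernel [measurable]:
  "cube_kernel q l \<in> borel_measurable (lborel_pow l)"
  unfolding cube_kernel_def by measurable

lemma measurable_unit_cube [measurable]: "unit_cube l \<in> sets (lborel_pow l)"
  by (rule sets_PiM_I_finite) auto

text \<open>The last coordinate enters only the last partial product, so the kernel gains a single
  factor. This drives the induction on the dimension.\<close>

lemma cube_kernel_Suc:
  "cube_kernel q (Suc l) (x(Suc l := y))
     = cube_kernel q l x * (- ln y / (1 - (\<Prod>m=1..l. x m) ^ q * y ^ q))"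
proof -
  have "(\<Prod>m=1..i. (x(Suc l := y)) m ^ q) = (\<Prod>m=1..i. x m ^ q)" if "i \<le> l" for i
    using that by (intro prod.cong) auto
  hence "cube_kernel q l (x(Suc l := y)) = cube_kernel q l x"
    unfolding cube_kernel_def by (intro prod.cong) auto
  moreover have "(\<Prod>m=1..Suc l. (x(Suc l := y)) m ^ q) = (\<Prod>m=1..l. x m) ^ q * y ^ q"
    by (simp add: prod_power_distrib)
  ultimately show ?thesis
    unfolding cube_kernel_def by (simp add: prod_power_distrib)
qed

text \<open>Integrating out the last variable, with the last denominator expanded as a geometric series,
  reproduces the recursion of \<^const>\<open>hsym\<close>.\<close>

lemma nn_integral_cube_kernel:
  assumes q: "q > 0"
  defines "a \<equiv> (\<lambda>n. 1 / (real (q * n) + 1)\<^sup>2)"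
  shows "(\<integral>\<^sup>+x. ennreal ((\<Prod>i=1..l. x i) ^ (q * j) * cube_kernel q l x) * indicator (unit_cube l) x \<partial>lborel_pow l)
           = ennreal (hsym a l j)"
proof (induction l arbitrary: j)
  case 0
  interpret product_sigma_finite "\<lambda>_::nat. lborel :: real measure" ..
  show ?case by (simp add: nn_integral_empty cube_kernel_def)
next
  case (Suc l)
  interpret product_sigma_finite "\<lambda>_::nat. lborel :: real measure" ..
  have a: "a n \<ge> 0" for n by (simp add: a_def)
  have sa: "summable a" unfolding a_def using summable_inverse_square_linear[OF q] .
  let ?G = "\<lambda>l j x. ennreal ((\<Prod>i=1..l. x i) ^ (q * j) * cube_kernel q l x) * indicator (unit_cube l) x"
  have [measurable]: "?G l j \<in> borel_measurable (lborel_pow l)" for l j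
    by measurable
  have ins: "{1..Suc l} = insert (Suc l) {1..l}" by auto
  have "(\<integral>\<^sup>+x. ?G (Suc l) j x \<partial>lborel_pow (Suc l))
      = (\<integral>\<^sup>+x. (\<integral>\<^sup>+y. ?G (Suc l) j (x(Suc l := y)) \<partial>lborel) \<partial>lborel_pow l)"
  proof -
    have "?G (Suc l) j \<in> borel_measurable (Pi\<^sub>M (insert (Suc l) {1..l}) (\<lambda>_. lborel))"
      unfolding ins[symmetric] by measurable
    from product_nn_integral_insert[OF _ _ this] show ?thesis
      unfolding ins[symmetric] by fastforce
  qed
  also have "\<dots> = (\<integral>\<^sup>+x. (\<Sum>n. ennreal (a (n + j)) * ?G l (n + j) x) \<partial>lborel_pow l)"
  proof (rule nn_integral_cong)
    fix x assume x: "x \<in> space (lborel_pow l)"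
    have ind: "indicator (unit_cube (Suc l)) (x(Suc l := y))
        = (indicator (unit_cube l) x * indicator {0..1} y :: ennreal)" for y
    proof -
      have "x \<in> extensional {1..l}" using x by (simp add: space_PiM PiE_def)
      hence "x(Suc l := y) \<in> unit_cube (Suc l) \<longleftrightarrow> x \<in> unit_cube l \<and> y \<in> {0..1}"
        by (auto simp: PiE_def Pi_iff extensional_def split: if_splits)
      thus ?thesis by (auto simp: indicator_def)
    qed
    have pr: "(\<Prod>i=1..Suc l. (x(Suc l := y)) i) = (\<Prod>i=1..l. x i) * y" for y
      by simp
    show "(\<integral>\<^sup>+y. ?G (Suc l) j (x(Suc l := y)) \<partial>lborel) = (\<Sum>n. ennreal (a (n + j)) * ?G l (n + j) x)"
    proof (cases "x \<in> unit_cube l")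
      case False
      thus ?thesis by (simp add: ind del: One_nat_def)
    next
      case True
      define Q where "Q = (\<Prod>i=1..l. x i)"
      define g where "g = cube_kernel q l x"
      have g: "g \<ge> 0" using cube_kernel_nonneg[OF True] by (simp add: g_def)
      have Q: "0 \<le> Q" "Q \<le> 1" using unit_cube_prod[OF True, of l] by (auto simp: Q_def)
      have "(\<integral>\<^sup>+y. ?G (Suc l) j (x(Suc l := y)) \<partial>lborel)
          = (\<integral>\<^sup>+y. ennreal (Q ^ (q * j) * g) *
                (ennreal (y ^ (q * j) * (- ln y / (1 - Q ^ q * y ^ q))) * indicator {0..1} y) \<partial>lborel)"
        using True Q g unfolding ind pr cube_kernel_Suc Q_def[symmetric] g_def[symmetric]
        by (intro nn_integral_cong)
           (auto simp: ennreal_mult'[symmetric] power_mult_distrib mult_ac indicator_def)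
      also have "\<dots> = ennreal (Q ^ (q * j) * g) *
          (\<integral>\<^sup>+y. ennreal (y ^ (q * j) * (- ln y / (1 - Q ^ q * y ^ q))) * indicator {0..1} y \<partial>lborel)"
        by (rule nn_integral_cmult) measurable
      also have "\<dots> = ennreal (Q ^ (q * j) * g) * (\<Sum>n. ennreal ((Q ^ q) ^ n * a (n + j)))"
        using Q q unfolding a_def by (subst nn_integral_power_ln_geometric) (auto simp only: power_le_one zero_le_power)
      also have "\<dots> = (\<Sum>n. ennreal (Q ^ (q * j) * g) * ennreal ((Q ^ q) ^ n * a (n + j)))"
        by (rule ennreal_suminf_cmult[symmetric])
      also have "\<dots> = (\<Sum>n. ennreal (a (n + j)) * ?G l (n + j) x)"
      proof (rule suminf_cong)
        fix n
        \<comment> \<open>The geometric series raises the power of \<open>Q\<close> from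
          \<open>q * j\<close> to \<open>q * (n + j)\<close>, which is why the induction keeps
          \<open>j\<close> arbitrary.\<close>
        have "(Q ^ (q * j) * g) * ((Q ^ q) ^ n * a (n + j)) = a (n + j) * (Q ^ (q * (n + j)) * g)"
          by (simp add: power_mult[symmetric] power_add distrib_left)
        hence "ennreal (Q ^ (q * j) * g) * ennreal ((Q ^ q) ^ n * a (n + j))
                 = ennreal (a (n + j)) * ennreal (Q ^ (q * (n + j)) * g)"
          using Q g a[of "n + j"] by (simp only: ennreal_mult'[symmetric] zero_le_power mult_nonneg_nonneg)
        thus "ennreal (Q ^ (q * j) * g) * ennreal ((Q ^ q) ^ n * a (n + j)) = ennreal (a (n + j)) * ?G l (n + j) x"
          using True unfolding Q_def g_def by simp
      qed
      finally show ?thesis .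
    qed
  qed
  also have "\<dots> = (\<Sum>n. ennreal (a (n + j)) * ennreal (hsym a l (n + j)))"
    by (subst nn_integral_suminf, measurable)
       (intro suminf_cong, subst nn_integral_cmult, measurable, simp only: Suc.IH)
  also have "\<dots> = (\<Sum>n. ennreal (a (n + j) * hsym a l (n + j)))"
    using a by (simp add: ennreal_mult')
  also have "\<dots> = ennreal (hsym a (Suc l) j)"
    using a hsym_bounds[OF a sa] summable_ignore_initial_segment[OF summable_hsym[OF a sa]]
    by (simp add: suminf_ennreal2)
  finally show ?case .
qed

text \<open>On the cube everything is nonnegative, so sum and integral may be exchanged. The result
  is finite by \<open>sw\<close>, hence is also the value of the Bochner integral.\<close>

lemma integral_cube_kernel:
  fixes w :: "nat \<Rightarrow> real"
  assumes q: "q > 0" and w: "\<And>j. 0 \<le> w j" "summable w"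
  defines "a \<equiv> (\<lambda>n. 1 / (real (q * n) + 1)\<^sup>2)"
  shows "(LINT x:unit_cube l|lborel_pow l. (\<Sum>j. w j * (\<Prod>i=1..l. x i) ^ (q * j)) * cube_kernel q l x)
           = (\<Sum>j. w j * hsym a l j)"
proof -
  have a: "a n \<ge> 0" for n by (simp add: a_def)
  have sa: "summable a" unfolding a_def using summable_inverse_square_linear[OF q] .
  have sw: "summable (\<lambda>j. w j * hsym a l j)"
    by (rule summable_comparison_test[OF _ summable_mult2[OF w(2), of "suminf a ^ l"]])
       (use w hsym_bounds[OF a sa] in \<open>auto simp: abs_mult intro!: mult_left_mono exI[of _ 0]\<close>)
  have [measurable]: "(\<lambda>x. (\<Sum>j. w j * (\<Prod>i=1..l. x i) ^ (q * j)) * cube_kernel q l x) \<in> borel_measurable (lborel_pow l)"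
    by measurable
  let ?K = "\<lambda>x. (\<Sum>j. w j * (\<Prod>i=1..l. x i) ^ (q * j))"
  have K: "0 \<le> w j * (\<Prod>i=1..l. x i) ^ (q * j)" "summable (\<lambda>j. w j * (\<Prod>i=1..l. x i) ^ (q * j))"
    if "x \<in> unit_cube l" for x j
  proof -
    have b: "0 \<le> (\<Prod>i=1..l. x i) ^ (q * j)" "(\<Prod>i=1..l. x i) ^ (q * j) \<le> 1" for j
      using unit_cube_prod[OF that, of l] by (auto intro: power_le_one)
    show "0 \<le> w j * (\<Prod>i=1..l. x i) ^ (q * j)" using w b by simp
    show "summable (\<lambda>j. w j * (\<Prod>i=1..l. x i) ^ (q * j))"
      by (rule summable_comparison_test[OF _ w(2)]) (use w b in \<open>auto simp: abs_mult intro!: mult_left_le exI[of _ 0]\<close>)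
  qed
  have "has_bochner_integral (lborel_pow l) (\<lambda>x. indicator (unit_cube l) x *\<^sub>R (?K x * cube_kernel q l x))
          (\<Sum>j. w j * hsym a l j)"
  proof (rule has_bochner_integral_nn_integral)
    show "AE x in lborel_pow l. 0 \<le> indicator (unit_cube l) x *\<^sub>R (?K x * cube_kernel q l x)"
    proof (rule AE_I2)
      fix x
      show "0 \<le> indicator (unit_cube l) x *\<^sub>R (?K x * cube_kernel q l x)"
      proof (cases "x \<in> unit_cube l")
        case True
        have "0 \<le> ?K x * cube_kernel q l x"
          by (intro mult_nonneg_nonneg suminf_nonneg K[OF True] cube_kernel_nonneg[OF True])
        thus ?thesis by simp
      qed simp
    qed
    have "(\<integral>\<^sup>+x. ennreal (indicator (unit_cube l) x *\<^sub>R (?K x * cube_kernel q l x)) \<partial>lborel_pow l)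
        = (\<integral>\<^sup>+x. (\<Sum>j. ennreal (w j) * (ennreal ((\<Prod>i=1..l. x i) ^ (q * j) * cube_kernel q l x)
              * indicator (unit_cube l) x)) \<partial>lborel_pow l)"
    proof (rule nn_integral_cong)
      fix x
      show "ennreal (indicator (unit_cube l) x *\<^sub>R (?K x * cube_kernel q l x))
          = (\<Sum>j. ennreal (w j) * (ennreal ((\<Prod>i=1..l. x i) ^ (q * j) * cube_kernel q l x) * indicator (unit_cube l) x))"
      proof (cases "x \<in> unit_cube l")
        case True
        have "(\<Sum>j. ennreal (w j * (\<Prod>i=1..l. x i) ^ (q * j) * cube_kernel q l x)) = ennreal (?K x * cube_kernel q l x)"
          using K[OF True] cube_kernel_nonneg[OF True]
          by (intro suminf_ennreal_eq sums_mult2 summable_sums) auto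
        thus ?thesis using True w by (simp add: ennreal_mult'[symmetric] mult.assoc)
      qed simp
    qed
    also have "\<dots> = (\<Sum>j. ennreal (w j) * ennreal (hsym a l j))"
      by (subst nn_integral_suminf, measurable)
         (intro suminf_cong, subst nn_integral_cmult, measurable,
          simp only: nn_integral_cube_kernel[OF q, folded a_def])
    also have "\<dots> = ennreal (\<Sum>j. w j * hsym a l j)"
      using w hsym_bounds[OF a sa] sw by (simp add: ennreal_mult'[symmetric] suminf_ennreal2)
    finally show "(\<integral>\<^sup>+x. ennreal (indicator (unit_cube l) x *\<^sub>R (?K x * cube_kernel q l x)) \<partial>lborel_pow l)
        = ennreal (\<Sum>j. w j * hsym a l j)" .
    show "0 \<le> (\<Sum>j. w j * hsym a l j)"
      using w hsym_bounds[OF a sa] sw by (intro suminf_nonneg) auto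
  qed measurable
  thus ?thesis unfolding set_lebesgue_integral_def by (rule has_bochner_integral_integral_eq)
qed

text \<open>Termwise integration of the arcsine series against the cotangent turns the leading coefficients
  into these weights, which are the coefficients of \<^const>\<open>K1\<close> (\<open>p = 1\<close>) and, up to the factor 4
  and an index shift, of \<^const>\<open>K0\<close> (\<open>p = 2\<close>).\<close>

definition arcsin_weight :: "nat \<Rightarrow> nat \<Rightarrow> real" where
  "arcsin_weight p j = arcsin_coeff p (2 * j + p) / (2 * real j + real p)"

text \<open>The bound 1 on the coefficients would only bound the weights by a multiple of 1/n, which
  is not summable. The extra factor \<open>n\<close> improves this to 1/n^2.\<close>

lemma arcsin_coeff_decay:
  assumes "p \<in> {1, 2}"
  shows "real n * arcsin_coeff p n \<le> 1"
proof -
  have "real n * arcsin_coeff q n \<le> 1" if "q \<in> {1, 2}" for q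
    using that
  proof (induction q n rule: arcsin_coeff.induct)
    case (3 q n)
    have IH: "real n * arcsin_coeff q n \<le> 1" using 3 by blast
    define X where "X = (if q < 2 then 0 else arcsin_coeff (q - 2) n)"
    have "real n * (real n * arcsin_coeff q n) + X \<le> real n + 1"
      using mult_left_mono[OF IH, of "real n"] arcsin_coeff_bounds(2)[of "q - 2" n] by (simp add: X_def)
    moreover have "real (Suc (Suc n)) * arcsin_coeff q (Suc (Suc n))
        = (real n * (real n * arcsin_coeff q n) + X) / (real n + 1)"
    proof -
      have "z * (w / (z * y)) = w / y" if "z > 0" for w y z :: real
        using that by simp
      from this[of "real n + 2"] show ?thesis
        by (simp add: X_def power2_eq_square mult.assoc add_ac)
    qed
    ultimately show ?case by simp
  qed auto
  with assms show ?thesis by blast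
qed

lemma arcsin_weight_nonneg: "0 \<le> arcsin_weight p j"
  by (simp add: arcsin_weight_def arcsin_coeff_bounds)

lemma summable_arcsin_weight:
  assumes p: "p \<in> {1, 2}"
  shows "summable (arcsin_weight p)"
proof (rule summable_comparison_test)
  show "summable (\<lambda>n. 1 / (real (1 * n) + 1)\<^sup>2)"
    by (rule summable_inverse_square_linear) simp
  have "arcsin_weight p j \<le> 1 / (real (1 * j) + 1)\<^sup>2" for j
  proof -
    define N where "N = 2 * real j + real p"
    have N: "real j + 1 \<le> N" using p by (auto simp: N_def)
    have "N * arcsin_coeff p (2 * j + p) \<le> 1"
      using arcsin_coeff_decay[OF p, of "2 * j + p"] by (simp add: N_def)
    moreover have "arcsin_weight p j = N * arcsin_coeff p (2 * j + p) / N\<^sup>2"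
      using N unfolding arcsin_weight_def N_def[symmetric] by (simp add: power2_eq_square)
    ultimately have "arcsin_weight p j \<le> 1 / N\<^sup>2"
      by (simp add: divide_right_mono)
    also have "\<dots> \<le> 1 / (real (1 * j) + 1)\<^sup>2"
      using N by (intro divide_left_mono power_mono) auto
    finally show ?thesis .
  qed
  thus "\<exists>N. \<forall>n\<ge>N. norm (arcsin_weight p n) \<le> 1 / (real (1 * n) + 1)\<^sup>2"
    by (simp add: arcsin_weight_nonneg)
qed

section \<open>Closed forms of the weights and the series \<open>K1\<close> and
  \<open>K0\<close>\<close>

lemma central_binomial_Suc:
  "(real j + 1) * real ((2 * Suc j) choose Suc j) = 2 * (2 * real j + 1) * real ((2 * j) choose j)"
proof -
  \<comment> \<open>The identity is stated over atoms, so that \<open>field_simps\<close> meets no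
    factorials.\<close>
  have cancel: "x * ((2 * x) * z * f / ((x * g) * (x * g))) = 2 * z * (f / (g * g))" if "x > 0" for x z f g :: real
    using that by (simp add: field_simps)
  have "fact (2 * Suc j) = (2 * (real j + 1)) * (2 * real j + 1) * fact (2 * j)"
    by (simp add: algebra_simps)
  moreover have "fact (Suc j) = (real j + 1) * fact j"
    by (simp add: algebra_simps)
  moreover have "real ((2 * Suc j) choose Suc j) = fact (2 * Suc j) / (fact (Suc j) * fact (Suc j))"
    using binomial_fact[of "Suc j" "2 * Suc j", where 'a = real] by simp
  moreover have "real ((2 * j) choose j) = fact (2 * j) / (fact j * fact j)"
    using binomial_fact[of j "2 * j", where 'a = real] by simp
  ultimately show ?thesis
    using cancel[of "real j + 1" "2 * real j + 1" "fact (2 * j)" "fact j"] by (simp only:)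
qed

text \<open>The classical expansion of the arcsine: for \<open>m = 1\<close> the recurrence is
  homogeneous and fixes the ratio of consecutive coefficients.\<close>

lemma arcsin_coeff_1: "arcsin_coeff 1 (2 * j + 1) = real ((2 * j) choose j) / (4 ^ j * (2 * real j + 1))"
proof (induction j)
  case (Suc j)
  define B where "B = real ((2 * j) choose j)"
  define B' where "B' = real ((2 * Suc j) choose Suc j)"
  have B: "B' = 2 * (2 * real j + 1) * B / (real j + 1)"
    using central_binomial_Suc[of j] by (simp add: B_def B'_def field_simps)
  have "arcsin_coeff 1 (2 * Suc j + 1) = (2 * real j + 1)\<^sup>2 * arcsin_coeff 1 (2 * j + 1) / ((2 * real j + 3) * (2 * real j + 2))"
    by (simp add: add_ac)
  also have "\<dots> = (2 * real j + 1)\<^sup>2 * (B / (4 ^ j * (2 * real j + 1))) / ((2 * real j + 3) * (2 * real j + 2))"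
    by (simp only: Suc.IH B_def)
  also have "\<dots> = B' / (4 ^ Suc j * (2 * real (Suc j) + 1))"
  proof -
    have "x\<^sup>2 * (B / (f * x)) / (y * (2 * z)) = (2 * x * B / z) / (4 * f * y)" if "x > 0" "y > 0" "z > 0" "f > 0" for x y z f
      using that by (simp add: field_simps power2_eq_square)
    from this[of "2 * real j + 1" "2 * real j + 3" "real j + 1" "4 ^ j"] show ?thesis
      unfolding B by (simp add: algebra_simps)
  qed
  finally show ?case by (simp only: B'_def)
qed simp

text \<open>The classical expansion of half the squared arcsine. Beyond index 2 the recurrence is
  homogeneous, as \<open>arcsin_coeff 0\<close> vanishes at positive indices.\<close>

lemma arcsin_coeff_2:
  "arcsin_coeff 2 (2 * j + 2) = 4 ^ Suc j / (4 * (real j + 1)\<^sup>2 * real ((2 * Suc j) choose Suc j))"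
proof (induction j)
  case 0
  show ?case by (simp add: numeral_2_eq_2)
next
  case (Suc j)
  define B where "B = real ((2 * Suc j) choose Suc j)"
  define B' where "B' = real ((2 * Suc (Suc j)) choose Suc (Suc j))"
  have B0: "B > 0" unfolding B_def of_nat_0_less_iff by (rule zero_less_binomial) simp
  have B: "B' = 2 * (2 * real j + 3) * B / (real j + 2)"
    using central_binomial_Suc[of "Suc j"] by (simp add: B_def B'_def field_simps)
  have "arcsin_coeff 2 (2 * Suc j + 2) = (2 * real j + 2)\<^sup>2 * arcsin_coeff 2 (2 * j + 2) / ((2 * real j + 4) * (2 * real j + 3))"
    using arcsin_coeff.simps(3)[of 2 "2 * j + 2"] by (simp add: add_ac arcsin_coeff_0_left del: arcsin_coeff.simps)
  also have "\<dots> = (2 * real j + 2)\<^sup>2 * (4 ^ Suc j / (4 * (real j + 1)\<^sup>2 * B)) / ((2 * real j + 4) * (2 * real j + 3))"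
    by (simp only: Suc.IH B_def)
  also have "\<dots> = 4 ^ Suc (Suc j) / (4 * (real (Suc j) + 1)\<^sup>2 * B')"
  proof -
    have "(2 * x)\<^sup>2 * (f / (4 * x\<^sup>2 * B)) / ((2 * y) * z) = 4 * f / (4 * y\<^sup>2 * (2 * z * B / y))" if "x > 0" "y > 0" "z > 0" for x y z f
      using that B0 by (simp add: field_simps power2_eq_square)
    from this[of "real j + 1" "real j + 2" "2 * real j + 3" "4 ^ Suc j"] show ?thesis
      unfolding B by (simp add: algebra_simps)
  qed
  finally show ?case by (simp only: B'_def)
qed

lemma K1_eq: "K1 z = (\<Sum>j. arcsin_weight 1 j * z ^ (2 * j))"
  unfolding K1_def
  by (intro suminf_cong)
     (simp add: arcsin_weight_def arcsin_coeff_1[simplified] power_divide power_mult power2_eq_square)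

text \<open>The factor \<open>z\<close> arises because the series starts at exponent 1; in
  \<open>I0_eq\<close> it cancels the \<open>x i\<close> in the denominators.\<close>

lemma K0_eq:
  assumes "0 \<le> z" "z \<le> 1"
  shows "K0 z = 4 * z * (\<Sum>j. arcsin_weight 2 j * z ^ j)"
proof -
  have s: "summable (\<lambda>j. arcsin_weight 2 j * z ^ j)"
    by (rule summable_comparison_test[OF _ summable_arcsin_weight[of 2]])
       (use assms in \<open>auto simp: abs_mult arcsin_weight_nonneg power_le_one intro!: mult_left_le exI[of _ 0]\<close>)
  have t: "(4 * z) ^ Suc j / (real (Suc j) ^ 3 * real ((2 * Suc j) choose Suc j)) = (8 * z) * (arcsin_weight 2 j * z ^ j)" for j
  proof -
    define B where "B = real ((2 * Suc j) choose Suc j)"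
    have cancel: "8 * (f / (4 * x\<^sup>2 * B) / (2 * x)) = f / (x ^ 3 * B)" for f x :: real
      by (simp add: power3_eq_cube power2_eq_square)
    have "arcsin_weight 2 j = 4 ^ Suc j / (4 * (real j + 1)\<^sup>2 * B) / (2 * (real j + 1))"
      unfolding arcsin_weight_def arcsin_coeff_2 B_def by (simp add: distrib_left)
    hence "8 * arcsin_weight 2 j = 4 ^ Suc j / (real (Suc j) ^ 3 * B)"
      by (simp only: cancel of_nat_Suc add.commute[of 1])
    hence "(8 * z) * (arcsin_weight 2 j * z ^ j) = 4 ^ Suc j / (real (Suc j) ^ 3 * B) * (z * z ^ j)"
      by (simp add: mult_ac)
    also have "\<dots> = (4 * z) ^ Suc j / (real (Suc j) ^ 3 * B)"
      by (simp add: power_mult_distrib)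
    finally show ?thesis by (simp only: B_def)
  qed
  show ?thesis unfolding K0_def t suminf_mult[OF s] by simp
qed

section \<open>The cube integrals as weighted sums of \<open>hsym\<close>\<close>

lemma I1_eq: "I1 l = (-1) ^ l * (\<Sum>j. arcsin_weight 1 j * hsym (\<lambda>n. 1 / (2 * real n + 1)\<^sup>2) l j)"
proof (cases "l = 0")
  case True
  thus ?thesis by (simp add: I1_def K1_eq)
next
  case False
  have "I1 l = (LINT x:unit_cube l|lborel_pow l. (-1) ^ l *
      ((\<Sum>j. arcsin_weight 1 j * (\<Prod>i=1..l. x i) ^ (2 * j)) * cube_kernel 2 l x))"
    using False by (simp add: I1_def K1_eq cube_kernel_def prod_uminus mult_ac flip: One_nat_def)
  also have "\<dots> = (-1) ^ l * (LINT x:unit_cube l|lborel_pow l.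
      (\<Sum>j. arcsin_weight 1 j * (\<Prod>i=1..l. x i) ^ (2 * j)) * cube_kernel 2 l x)"
    by (rule set_integral_mult_right)
  also have "\<dots> = (-1) ^ l * (\<Sum>j. arcsin_weight 1 j * hsym (\<lambda>n. 1 / (2 * real n + 1)\<^sup>2) l j)"
    using integral_cube_kernel[of 2 "arcsin_weight 1" l] summable_arcsin_weight[of 1]
    by (simp add: arcsin_weight_nonneg flip: One_nat_def)
  finally show ?thesis .
qed

lemma I0_eq: "I0 l = (-1) ^ l * (\<Sum>j. 4 * arcsin_weight 2 j * hsym (\<lambda>n. 1 / (real n + 1)\<^sup>2) l j)"
proof (cases "l = 0")
  case True
  thus ?thesis using suminf_mult[OF summable_arcsin_weight[of 2], of 4] by (simp add: I0_def K0_eq)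
next
  case False
  have "I0 l = (LINT x:unit_cube l|lborel_pow l. (-1) ^ l *
      ((\<Sum>j. 4 * arcsin_weight 2 j * (\<Prod>i=1..l. x i) ^ (1 * j)) * cube_kernel 1 l x))"
    unfolding I0_def if_not_P[OF False]
  proof (rule set_lebesgue_integral_cong[OF measurable_unit_cube], intro allI impI)
    fix x assume x: "x \<in> unit_cube l"
    let ?P = "\<Prod>i=1..l. x i"
    have P: "0 \<le> ?P" "?P \<le> 1" using unit_cube_prod[OF x, of l] by auto
    have s: "summable (\<lambda>j. arcsin_weight 2 j * ?P ^ j)"
      by (rule summable_comparison_test[OF _ summable_arcsin_weight[of 2]])
         (use P in \<open>auto simp: abs_mult arcsin_weight_nonneg power_le_one intro!: mult_left_le exI[of _ 0]\<close>)
    have "?P * (\<Prod>i=1..l. ln (x i) / (x i * (1 - (\<Prod>m=1..i. x m))))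
        = (\<Prod>i=1..l. - 1 * (- ln (x i) / (1 - (\<Prod>m=1..i. x m ^ 1))))"
      unfolding prod.distrib[symmetric]
    proof (rule prod.cong)
      fix i
      \<comment> \<open>A zero coordinate relies on the convention \<open>ln 0 = 0\<close>, by which
        both sides vanish.\<close>
      show "x i * (ln (x i) / (x i * (1 - (\<Prod>m=1..i. x m)))) = - 1 * (- ln (x i) / (1 - (\<Prod>m=1..i. x m ^ 1)))"
        by (cases "x i = 0") simp_all
    qed simp
    also have "\<dots> = (-1) ^ l * cube_kernel 1 l x"
      unfolding cube_kernel_def prod.distrib by simp
    finally have pr: "?P * (\<Prod>i=1..l. ln (x i) / (x i * (1 - (\<Prod>m=1..i. x m)))) = (-1) ^ l * cube_kernel 1 l x" .
    have "K0 ?P * (\<Prod>i=1..l. ln (x i) / (x i * (1 - (\<Prod>m=1..i. x m))))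
        = 4 * (\<Sum>j. arcsin_weight 2 j * ?P ^ j) * (?P * (\<Prod>i=1..l. ln (x i) / (x i * (1 - (\<Prod>m=1..i. x m)))))"
      unfolding K0_eq[OF P] by (simp only: mult_ac)
    also have "\<dots> = (-1) ^ l * ((4 * (\<Sum>j. arcsin_weight 2 j * ?P ^ j)) * cube_kernel 1 l x)"
      unfolding pr by (simp only: mult_ac)
    finally have "K0 ?P * (\<Prod>i=1..l. ln (x i) / (x i * (1 - (\<Prod>m=1..i. x m))))
        = (-1) ^ l * ((4 * (\<Sum>j. arcsin_weight 2 j * ?P ^ j)) * cube_kernel 1 l x)" .
    thus "K0 ?P * (\<Prod>i=1..l. ln (x i) / (x i * (1 - (\<Prod>m=1..i. x m))))
        = (-1) ^ l * ((\<Sum>j. 4 * arcsin_weight 2 j * ?P ^ (1 * j)) * cube_kernel 1 l x)"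
      unfolding suminf_mult[OF s, symmetric] by (simp only: mult.assoc mult_1)
  qed
  also have "\<dots> = (-1) ^ l * (LINT x:unit_cube l|lborel_pow l.
      (\<Sum>j. 4 * arcsin_weight 2 j * (\<Prod>i=1..l. x i) ^ (1 * j)) * cube_kernel 1 l x)"
    by (rule set_integral_mult_right)
  also have "\<dots> = (-1) ^ l * (\<Sum>j. 4 * arcsin_weight 2 j * hsym (\<lambda>n. 1 / (real n + 1)\<^sup>2) l j)"
    using integral_cube_kernel[of 1 "\<lambda>j. 4 * arcsin_weight 2 j" l] summable_mult[OF summable_arcsin_weight[of 2], of 4]
    by (simp add: arcsin_weight_nonneg flip: One_nat_def)
  finally show ?thesis .
qed

section \<open>Moments of the cotangent\<close>

lemma nn_integral_sin_cos_half:
  "(\<integral>\<^sup>+\<theta>. ennreal (sin (\<theta> / 2) ^ n * cos (\<theta> / 2)) * indicator {0..pi} \<theta> \<partial>lborel) = ennreal (2 / (real n + 1))"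
proof -
  define F where "F = (\<lambda>\<theta>. 2 / (real n + 1) * sin (\<theta> / 2) ^ Suc n)"
  have "((\<lambda>\<theta>. sin (\<theta> / 2) ^ n * cos (\<theta> / 2)) has_integral (F pi - F 0)) {0..pi}"
  proof (rule fundamental_theorem_of_calculus)
    fix x :: real
    have "((\<lambda>\<theta>. sin (\<theta> / 2) ^ Suc n) has_real_derivative
        (1 + real n) * (cos (x / 2) * (1 / 2) * sin (x / 2) ^ n)) (at x within {0..pi})"
      by (rule DERIV_power_Suc) (auto intro!: derivative_eq_intros)
    from DERIV_cmult[OF this, of "2 / (real n + 1)"]
    have "(F has_real_derivative 2 / (real n + 1) * ((1 + real n) * (cos (x / 2) * (1 / 2) * sin (x / 2) ^ n))) (at x within {0..pi})"
      by (simp only: F_def)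
    also have "2 / (real n + 1) * ((1 + real n) * (cos (x / 2) * (1 / 2) * sin (x / 2) ^ n)) = sin (x / 2) ^ n * cos (x / 2)"
      by (simp add: field_simps)
    finally show "(F has_vector_derivative sin (x / 2) ^ n * cos (x / 2)) (at x within {0..pi})"
      by (simp add: has_real_derivative_iff_has_vector_derivative)
  qed simp
  also have "F pi - F 0 = 2 / (real n + 1)" by (simp add: F_def)
  finally show ?thesis
    by (rule nn_integral_has_integral_lebesgue'[rotated]) (auto intro!: mult_nonneg_nonneg zero_le_power sin_ge_zero cos_ge_zero)
qed

text \<open>With \<open>u = \<theta> / 2\<close>, multiplying the arcsine series by
  \<open>cot u\<close> leaves the terms \<open>sin u ^ (2 * j + p - 1) * cos u\<close>, integrated
  by \<open>nn_integral_sin_cos_half\<close>. Nonnegativity justifies termwise integration.\<close>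

lemma C_eq:
  assumes p: "p \<in> {1, 2}"
    and s: "summable (\<lambda>j. arcsin_coeff (2 * k + p) (2 * j + p) / (2 * real j + real p))"
  shows "C (2 * k + p) = 2 ^ (2 * k + p) * (\<Sum>j. arcsin_coeff (2 * k + p) (2 * j + p) / (2 * real j + real p))"
proof -
  define m where "m = 2 * k + p"
  define A where "A = (\<lambda>j. arcsin_coeff m (2 * j + p))"
  have A: "A j \<ge> 0" for j by (simp add: A_def arcsin_coeff_bounds)
  have m: "(2::real) ^ m = 2 * 2 ^ (m - 1)" using p by (auto simp: m_def simp flip: power_Suc)
  have "has_bochner_integral lborel (\<lambda>\<theta>. indicator {0..pi} \<theta> *\<^sub>R (\<theta> ^ m / 2 * cot (\<theta> / 2)))
          (fact m * (2 ^ m * (\<Sum>j. A j / (2 * real j + real p))))"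
  proof (rule has_bochner_integral_nn_integral)
    have nonneg: "0 \<le> indicator {0..pi} \<theta> *\<^sub>R (\<theta> ^ m / 2 * cot (\<theta> / 2))" for \<theta>
      by (auto simp: indicator_def cot_def intro!: mult_nonneg_nonneg divide_nonneg_nonneg sin_ge_zero cos_ge_zero)
    thus "AE \<theta> in lborel. 0 \<le> indicator {0..pi} \<theta> *\<^sub>R (\<theta> ^ m / 2 * cot (\<theta> / 2))" by simp
    show "(\<lambda>\<theta>. indicator {0..pi} \<theta> *\<^sub>R (\<theta> ^ m / 2 * cot (\<theta> / 2))) \<in> borel_measurable lborel"
      unfolding cot_def by measurable
    show "0 \<le> fact m * (2 ^ m * (\<Sum>j. A j / (2 * real j + real p)))"
      using s A by (intro mult_nonneg_nonneg suminf_nonneg) (auto simp: A_def m_def)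
    have "(\<integral>\<^sup>+\<theta>. ennreal (indicator {0..pi} \<theta> *\<^sub>R (\<theta> ^ m / 2 * cot (\<theta> / 2))) \<partial>lborel)
        = (\<integral>\<^sup>+\<theta>. (\<Sum>j. ennreal (fact m * 2 ^ (m - 1) * A j) *
             (ennreal (sin (\<theta> / 2) ^ (2 * j + p - 1) * cos (\<theta> / 2)) * indicator {0..pi} \<theta>)) \<partial>lborel)"
    \<comment> \<open>Both endpoints are dropped: the cotangent has its pole at 0, and at
      \<open>pi\<close> the expansion, proved for |u| < pi / 2, does not apply.\<close>
    proof (rule nn_integral_cong_AE, use AE_lborel_singleton[of 0] AE_lborel_singleton[of pi] in eventually_elim)
      fix \<theta> :: real assume ne: "\<theta> \<noteq> 0" "\<theta> \<noteq> pi"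
      show "ennreal (indicator {0..pi} \<theta> *\<^sub>R (\<theta> ^ m / 2 * cot (\<theta> / 2))) =
         (\<Sum>j. ennreal (fact m * 2 ^ (m - 1) * A j) *
             (ennreal (sin (\<theta> / 2) ^ (2 * j + p - 1) * cos (\<theta> / 2)) * indicator {0..pi} \<theta>))"
      proof (cases "0 < \<theta> \<and> \<theta> < pi")
        case False
        hence "\<theta> \<notin> {0..pi}" using ne by auto
        thus ?thesis by simp
      next
        case True
        define u where "u = \<theta> / 2"
        have u: "0 < u" "u < pi / 2" "\<bar>u\<bar> < pi / 2" using True by (auto simp: u_def)
        have su: "sin u > 0" using u by (intro sin_gt_zero) auto
        have cu: "cos u > 0" using u by (intro cos_gt_zero_pi) auto
        have "(\<lambda>j. (fact m * 2 ^ (m - 1) * cot u) * (A j * sin u ^ (2 * j + p))) sums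
                ((fact m * 2 ^ (m - 1) * cot u) * (u ^ m / fact m))"
          unfolding A_def m_def by (intro sums_mult arcsin_coeff_sums p u)
        moreover have "(fact m * 2 ^ (m - 1) * cot u) * (A j * sin u ^ (2 * j + p))
            = fact m * 2 ^ (m - 1) * A j * (sin u ^ (2 * j + p - 1) * cos u)" for j
        proof -
          have "sin u ^ (2 * j + p) = sin u * sin u ^ (2 * j + p - 1)" using p by (auto simp flip: power_Suc)
          thus ?thesis using su by (simp add: cot_def)
        qed
        moreover have "(fact m * 2 ^ (m - 1) * cot u) * (u ^ m / fact m) = \<theta> ^ m / 2 * cot (\<theta> / 2)"
          by (simp add: u_def power_divide m)
        ultimately have "(\<lambda>j. fact m * 2 ^ (m - 1) * A j * (sin u ^ (2 * j + p - 1) * cos u)) sums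
            (\<theta> ^ m / 2 * cot (\<theta> / 2))" by (simp only:)
        hence sum_eq: "(\<Sum>j. ennreal (fact m * 2 ^ (m - 1) * A j * (sin u ^ (2 * j + p - 1) * cos u))) = ennreal (\<theta> ^ m / 2 * cot (\<theta> / 2))"
          using A su cu by (intro suminf_ennreal_eq) auto
        have "(\<Sum>j. ennreal (fact m * 2 ^ (m - 1) * A j) * ennreal (sin u ^ (2 * j + p - 1) * cos u)) = ennreal (\<theta> ^ m / 2 * cot (\<theta> / 2))"
        proof -
          have "0 \<le> fact m * 2 ^ (m - 1) * A j" for j using A[of j] by simp
          from ennreal_mult'[OF this] sum_eq show ?thesis by (simp only:)
        qed
        thus ?thesis using True by (simp add: u_def)
      qed
    qed
    also have "\<dots> = (\<Sum>j. ennreal (fact m * 2 ^ (m - 1) * A j) * ennreal (2 / (real (2 * j + p - 1) + 1)))"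
      by (subst nn_integral_suminf, measurable)
         (intro suminf_cong, subst nn_integral_cmult, measurable, simp only: nn_integral_sin_cos_half)
    also have "\<dots> = (\<Sum>j. ennreal (fact m * 2 ^ m * (A j / (2 * real j + real p))))"
    proof (rule suminf_cong)
      fix j
      have "real (2 * j + p - 1) + 1 = 2 * real j + real p" using p by auto
      thus "ennreal (fact m * 2 ^ (m - 1) * A j) * ennreal (2 / (real (2 * j + p - 1) + 1))
         = ennreal (fact m * 2 ^ m * (A j / (2 * real j + real p)))"
        using A[of j] by (simp add: ennreal_mult'[symmetric] m mult_ac)
    qed
    also have "\<dots> = ennreal (fact m * 2 ^ m * (\<Sum>j. A j / (2 * real j + real p)))"
      using A s by (intro suminf_ennreal_eq sums_mult summable_sums) (auto simp: A_def m_def)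
    finally show "(\<integral>\<^sup>+\<theta>. ennreal (indicator {0..pi} \<theta> *\<^sub>R (\<theta> ^ m / 2 * cot (\<theta> / 2))) \<partial>lborel)
        = ennreal (fact m * (2 ^ m * (\<Sum>j. A j / (2 * real j + real p))))"
      by (simp only: mult.assoc)
  qed
  hence "(LBINT \<theta>:{0..pi}. \<theta> ^ m / 2 * cot (\<theta> / 2)) = fact m * (2 ^ m * (\<Sum>j. A j / (2 * real j + real p)))"
    unfolding set_lebesgue_integral_def by (rule has_bochner_integral_integral_eq)
  thus ?thesis unfolding C_def m_def[symmetric] A_def by simp
qed

text \<open>The factor \<open>(real p)^2\<close> turns the sequence into that of the cube integrals,
  for \<open>p = 2\<close> into \<open>1 / (n + 1)^2\<close>. By homogeneity of \<open>esym\<close>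
  it is paid for by \<open>real p ^ (2 * k)\<close>.\<close>

lemma C_eq_sum_hsym:
  assumes p: "p \<in> {1, 2}"
  defines "a \<equiv> (\<lambda>n. (real p)\<^sup>2 * (1 / (2 * real n + real p)\<^sup>2))"
  shows "C (2 * k + p) = 2 ^ (2 * k + p) / real p ^ (2 * k) *
           (\<Sum>l\<le>k. (-1) ^ l * (real p * (pi / 2)) ^ (2 * (k - l)) / fact (2 * (k - l) + p - 1)
              * (\<Sum>j. arcsin_weight p j * hsym a l j))"
proof -
  define w where "w = arcsin_weight p"
  define e where "e = (\<lambda>k. (real p * (pi / 2)) ^ (2 * k) / fact (2 * k + p - 1))"
  have p0: "real p > 0" using p by auto
  have a: "a n \<ge> 0" for n by (simp add: a_def)
  have sa: "summable a"
  proof (rule summable_comparison_test)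
    show "summable (\<lambda>n. (real p)\<^sup>2 * (1 / (real (1 * n) + 1)\<^sup>2))"
      by (rule summable_mult[OF summable_inverse_square_linear]) simp
    have "a n \<le> (real p)\<^sup>2 * (1 / (real (1 * n) + 1)\<^sup>2)" for n
      unfolding a_def using p by (intro mult_left_mono divide_left_mono power_mono) auto
    thus "\<exists>N. \<forall>n\<ge>N. norm (a n) \<le> (real p)\<^sup>2 * (1 / (real (1 * n) + 1)\<^sup>2)" using a by auto
  qed
  have esym_a: "esym a k j = real p ^ (2 * k) * esym (\<lambda>n. 1 / (2 * real n + real p)\<^sup>2) k j" for k j
    unfolding a_def by (subst esym_scale) (simp add: power_mult)
  have "esym a k \<longlonglongrightarrow> e k" for k
  proof -
    have "(\<lambda>j. real p ^ (2 * k) * esym (\<lambda>n. 1 / (2 * real n + real p)\<^sup>2) k j)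
        \<longlonglongrightarrow> real p ^ (2 * k) * ((pi / 2) ^ (2 * k) / fact (2 * k + p - 1))"
      by (intro tendsto_mult_left esym_tendsto p)
    thus ?thesis by (simp add: e_def esym_a[symmetric] power_mult_distrib power_divide)
  qed
  hence E: "esym a k j = (\<Sum>l\<le>k. (-1) ^ l * hsym a l j * e (k - l))" for j
    by (rule esym_eq_sum_hsym[OF a sa])
  have sw: "summable (\<lambda>j. w j * hsym a l j)" for l
    by (rule summable_comparison_test[OF _ summable_mult2[OF summable_arcsin_weight[OF p], of "suminf a ^ l"]])
       (use hsym_bounds[OF a sa] in \<open>auto simp: w_def arcsin_weight_nonneg abs_mult intro!: mult_left_mono exI[of _ 0]\<close>)
  have term_eq: "arcsin_coeff (2 * k + p) (2 * j + p) / (2 * real j + real p)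
      = 1 / real p ^ (2 * k) * (\<Sum>l\<le>k. ((-1) ^ l * e (k - l)) * (w j * hsym a l j))" for j
  proof -
    have "esym (\<lambda>n. 1 / (2 * real n + real p)\<^sup>2) k j = esym a k j / real p ^ (2 * k)"
      using p0 by (simp add: esym_a)
    thus ?thesis
      unfolding arcsin_coeff_eq_esym[OF p] E
      by (simp add: w_def arcsin_weight_def sum_distrib_left sum_divide_distrib mult_ac)
  qed
  have "(\<lambda>j. arcsin_coeff (2 * k + p) (2 * j + p) / (2 * real j + real p)) sums
      (1 / real p ^ (2 * k) * (\<Sum>l\<le>k. ((-1) ^ l * e (k - l)) * (\<Sum>j. w j * hsym a l j)))"
    unfolding term_eq by (intro sums_mult sums_sum summable_sums sw)
  \<comment> \<open>The \<open>sums\<close> fact serves twice: it provides the summability demanded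
    by \<open>C_eq\<close> and evaluates the series.\<close>
  from C_eq[OF p sums_summable[OF this]] sums_unique[OF this, symmetric]
  have "C (2 * k + p) = 2 ^ (2 * k + p) * 
      (1 / real p ^ (2 * k) * (\<Sum>l\<le>k. ((-1) ^ l * e (k - l)) * (\<Sum>j. w j * hsym a l j)))"
    by (simp only:)
  thus ?thesis by (simp add: e_def w_def)
qed

theorem theorem1:
  fixes k :: nat
  shows "C (2 * k + 1) = (\<Sum>l=0..k. 2 ^ (2 * l + 1) * (pi ^ (2 * k - 2 * l) / fact (2 * k - 2 * l)) * I1 l) \<and>
         C (2 * k + 2) = (\<Sum>l=0..k. pi ^ (2 * k - 2 * l) / fact (2 * k - 2 * l + 1) * I0 l)"
proof
  have "C (2 * k + 1) = (\<Sum>l\<le>k. 2 ^ (2 * k + 1) * ((pi / 2) ^ (2 * (k - l)) / fact (2 * (k - l)) * I1 l))"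
    using C_eq_sum_hsym[of 1 k] by (simp add: I1_eq sum_distrib_left mult_ac)
  also have "\<dots> = (\<Sum>l=0..k. 2 ^ (2 * l + 1) * (pi ^ (2 * k - 2 * l) / fact (2 * k - 2 * l)) * I1 l)"
  proof (rule sum.cong)
    fix l assume "l \<in> {0..k}"
    \<comment> \<open>The powers of \<open>pi / 2\<close> take \<open>2 ^ (2 * (k - l))\<close> out
      of the prefactor and leave \<open>2 ^ (2 * l + 1)\<close>.\<close>
    hence "2 * k + 1 = (2 * l + 1) + 2 * (k - l)" by simp
    hence "(2::real) ^ (2 * k + 1) = 2 ^ (2 * l + 1) * 2 ^ (2 * (k - l))" by (metis power_add)
    thus "2 ^ (2 * k + 1) * ((pi / 2) ^ (2 * (k - l)) / fact (2 * (k - l)) * I1 l)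
        = 2 ^ (2 * l + 1) * (pi ^ (2 * k - 2 * l) / fact (2 * k - 2 * l)) * I1 l"
      by (simp add: power_divide diff_mult_distrib2)
  qed auto
  finally show "C (2 * k + 1) = (\<Sum>l=0..k. 2 ^ (2 * l + 1) * (pi ^ (2 * k - 2 * l) / fact (2 * k - 2 * l)) * I1 l)" .
next
  have a: "(real 2)\<^sup>2 * (1 / (2 * real n + real 2)\<^sup>2) = 1 / (real n + 1)\<^sup>2" for n
  proof -
    have "(2 * real n + real 2)\<^sup>2 = 4 * (real n + 1)\<^sup>2" by (simp add: power2_eq_square algebra_simps)
    thus ?thesis by simp
  qed
  have h: "(\<Sum>j. 4 * arcsin_weight 2 j * hsym (\<lambda>n. 1 / (real n + 1)\<^sup>2) l j)
      = 4 * (\<Sum>j. arcsin_weight 2 j * hsym (\<lambda>n. 1 / (real n + 1)\<^sup>2) l j)" for l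
  proof -
    have sa: "summable (\<lambda>n. 1 / (real n + 1)\<^sup>2)" using summable_inverse_square_linear[of 1] by simp
    have "summable (\<lambda>j. arcsin_weight 2 j * hsym (\<lambda>n. 1 / (real n + 1)\<^sup>2) l j)"
      by (rule summable_comparison_test[OF _ summable_mult2[OF summable_arcsin_weight[of 2], of "suminf (\<lambda>n. 1 / (real n + 1)\<^sup>2) ^ l"]])
         (use hsym_bounds[OF _ sa] in \<open>auto simp: arcsin_weight_nonneg abs_mult intro!: mult_left_mono exI[of _ 0]\<close>)
    from suminf_mult[OF this, of 4] show ?thesis by (simp add: mult.assoc)
  qed
  \<comment> \<open>For \<open>p = 2\<close> the prefactor collapses to 4, exactly the factor that
    \<open>I0\<close> inherits from \<open>K0_eq\<close>.\<close>
  have "(2::real) ^ (2 * k + 2) / real 2 ^ (2 * k) = 4" by simp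
  moreover have "I0 l = (-1) ^ l * (4 * (\<Sum>j. arcsin_weight 2 j * hsym (\<lambda>n. 1 / (real n + 1)\<^sup>2) l j))" for l
    by (simp only: I0_eq h)
  ultimately have "C (2 * k + 2) = (\<Sum>l\<le>k. pi ^ (2 * (k - l)) / fact (2 * (k - l) + 1) * I0 l)"
    using C_eq_sum_hsym[of 2 k] unfolding a by (simp add: sum_distrib_left mult_ac)
  thus "C (2 * k + 2) = (\<Sum>l=0..k. pi ^ (2 * k - 2 * l) / fact (2 * k - 2 * l + 1) * I0 l)"
    by (simp add: atMost_atLeast0 diff_mult_distrib2)
qed

end
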